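(* Let $t\ge 1$ be an integer and let $N,p\ge 2$ be two coprime integers. Let $\Omega=\{1,2\}^{\mathbb{N}}$, $N_1=N_2=tN$, $B_1=\{0,1,\ldots,N-1\}$ and $B_2=p\cdot\{0,1,\ldots,N-1\}$. For $\omega=(\omega_k)_{k=1}^\infty\in\Omega$ let $$\mu_\omega=\delta_{(tN)^{-1}B_{\omega_1}}*\delta_{(tN)^{-2}B_{\omega_2}}*\cdots*\delta_{(tN)^{-k}B_{\omega_k}}*\cdots .$$ (i) If $t=1$, then for $\omega\in\Omega$, the infinite convolution $\mu_\omega$ is a spectral measure if and only if $\omega=2^\infty$ or the symbol "1" occurs infinitely many times in $\omega$. (ii) If $t\ge 2$, then for all $\omega\in\Omega$, the infinite convolution $\mu_\omega$ is a spectral measure.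
   Context: For a finite nonempty set $A\subset\mathbb{R}$, $\delta_A=\frac{1}{\#A}\sum_{a\in A}\delta_a$, where $\delta_a$ is the Dirac measure at $a$; $cA=\{ca: a\in A\}$. Infinite convolutions are understood as weak limits (against bounded continuous functions) of their finite partial convolutions. $2^\infty$ denotes the constant sequence $222\cdots$. A Borel probability measure $\mu$ on $\mathbb{R}$ is a spectral measure if there is a set $\Lambda\subset\mathbb{R}$ such that $\{e^{2\pi i\lambda x}:\lambda\in\Lambda\}$ is an orthonormal basis of $L^2(\mu)$. *)

theory Defs
  imports "HOL-Probability.Probability"
begin

definition uniform_dirac :: "real set \<Rightarrow> real measure" where
  "uniform_dirac A = distr (measure_pmf (pmf_of_set A)) borel (\<lambda>a. a)"

lemma emeasure_uniform_dirac:
  assumes "finite A" "A \<noteq> {}" "X \<in> sets borel"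
  shows "emeasure (uniform_dirac A) X = (\<Sum>a\<in>A. emeasure (return borel a) X) / card A"
proof -
  have "(\<Sum>a\<in>A. emeasure (return borel a) X) = (\<Sum>a\<in>A. indicator X a)"
    using assms by (intro sum.cong) auto
  also have "\<dots> = card (A \<inter> X)"
    using assms by (simp add: indicator_def sum.If_cases Int_def)
  finally have "(\<Sum>a\<in>A. emeasure (return borel a) X) = of_nat (card (A \<inter> X))"
    by simp
  moreover have "emeasure (uniform_dirac A) X = of_nat (card (A \<inter> X)) / of_nat (card A)"
    using assms
    by (simp add: uniform_dirac_def emeasure_distr emeasure_pmf_of_set ennreal_of_nat_eq_real_of_nat
        divide_ennreal card_gt_0_iff)
  ultimately show ?thesis by simp
qed

primrec partial_convolution :: "(nat \<Rightarrow> real measure) \<Rightarrow> nat \<Rightarrow> real measure" where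
  "partial_convolution \<nu> 0 = \<nu> 0"
| "partial_convolution \<nu> (Suc n) = convolution (partial_convolution \<nu> n) (\<nu> (Suc n))"

definition weak_limit :: "(nat \<Rightarrow> real measure) \<Rightarrow> real measure \<Rightarrow> bool" where
  "weak_limit M_seq M \<longleftrightarrow> real_distribution M \<and>
     (\<forall>f :: real \<Rightarrow> real. continuous_on UNIV f \<longrightarrow> bounded (range f) \<longrightarrow>
        (\<lambda>n. integral\<^sup>L (M_seq n) f) \<longlonglongrightarrow> integral\<^sup>L M f)"

lemma weak_limit_iff_weak_conv_m:
  assumes "\<And>n. real_distribution (M_seq n)" "real_distribution M"
  shows "weak_limit M_seq M \<longleftrightarrow> weak_conv_m M_seq M"
proof
  assume L: "weak_limit M_seq M"
  show "weak_conv_m M_seq M"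
  proof (rule integral_bdd_continuous_conv_imp_weak_conv[OF assms])
    fix f :: "real \<Rightarrow> real"
    assume f: "\<And>x. isCont f x" "\<And>x. \<bar>f x\<bar> \<le> 1"
    have "bounded (range f)" using f(2) by (auto simp: bounded_iff)
    then show "(\<lambda>n. integral\<^sup>L (M_seq n) f) \<longlonglongrightarrow> integral\<^sup>L M f"
      using L f(1) by (auto simp: weak_limit_def continuous_on_eq_continuous_at)
  qed
next
  assume L: "weak_conv_m M_seq M"
  show "weak_limit M_seq M"
    unfolding weak_limit_def
  proof (intro conjI allI impI)
    fix f :: "real \<Rightarrow> real" assume f: "continuous_on UNIV f" "bounded (range f)"
    obtain B where "\<And>x. norm (f x) \<le> B" using f(2) by (auto simp: bounded_iff)
    then show "(\<lambda>n. integral\<^sup>L (M_seq n) f) \<longlonglongrightarrow> integral\<^sup>L M f"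
      using f(1) by (intro weak_conv_imp_integral_bdd_continuous_conv[OF assms L, of f B])
        (auto simp: continuous_on_eq_continuous_at)
  qed (fact assms)
qed

lemma weak_limit_unique:
  assumes L: "weak_limit M_seq M" "weak_limit M_seq M'"
  shows "M = M'"
proof (rule Levy_uniqueness)
  show M: "real_distribution M" and M': "real_distribution M'"
    using L by (auto simp: weak_limit_def)
  show "char M = char M'"
  proof
    fix s
    have 1: "integral\<^sup>L M f = integral\<^sup>L M' f"
      if "continuous_on UNIV f" "bounded (range f)" for f :: "real \<Rightarrow> real"
      using L that by (auto simp: weak_limit_def intro: LIMSEQ_unique)
    have c: "integral\<^sup>L M (\<lambda>x. cos (s * x)) = integral\<^sup>L M' (\<lambda>x. cos (s * x))"
      by (rule 1) (auto intro!: continuous_intros simp: bounded_iff intro: exI[of _ 1])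
    have s: "integral\<^sup>L M (\<lambda>x. sin (s * x)) = integral\<^sup>L M' (\<lambda>x. sin (s * x))"
      by (rule 1) (auto intro!: continuous_intros simp: bounded_iff intro: exI[of _ 1])
    interpret M: real_distribution M by (rule M)
    interpret M': real_distribution M' by (rule M')
    have iM: "integrable M (\<lambda>x. iexp (s * x))"
      by (intro M.integrable_const_bound[where B=1]) auto
    have iM': "integrable M' (\<lambda>x. iexp (s * x))"
      by (intro M'.integrable_const_bound[where B=1]) auto
    show "char M s = char M' s"
      unfolding char_def using c s iM iM'
      by (intro complex_eqI)
         (simp_all add: Re_exp Im_exp flip: integral_Re integral_Im)
  qed
qed

definition infinite_convolution :: "(nat \<Rightarrow> real measure) \<Rightarrow> real measure" where
  "infinite_convolution \<nu> = (THE \<mu>. weak_limit (partial_convolution \<nu>) \<mu>)"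

text \<open>
  \<open>L\<^sup>2(\<mu>)\<close> is represented by functions rather than by classes modulo equality almost
  everywhere.
\<close>

definition L2_space :: "real measure \<Rightarrow> (real \<Rightarrow> complex) set" where
  "L2_space \<mu> = {f \<in> borel_measurable \<mu>. integrable \<mu> (\<lambda>x. (cmod (f x))\<^sup>2)}"

definition L2_inner :: "real measure \<Rightarrow> (real \<Rightarrow> complex) \<Rightarrow> (real \<Rightarrow> complex) \<Rightarrow> complex" where
  "L2_inner \<mu> f g = (\<integral>x. f x * cnj (g x) \<partial>\<mu>)"

definition L2_norm :: "real measure \<Rightarrow> (real \<Rightarrow> complex) \<Rightarrow> real" where
  "L2_norm \<mu> f = sqrt (\<integral>x. (cmod (f x))\<^sup>2 \<partial>\<mu>)"

text \<open>
  An orthonormal basis is an orthonormal family with dense linear span. It is indexed: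
  distinct indices must give orthogonal functions, so the family has no repetitions modulo
  equality almost everywhere.
\<close>

definition L2_orthonormal_basis ::
    "real measure \<Rightarrow> 'i set \<Rightarrow> ('i \<Rightarrow> real \<Rightarrow> complex) \<Rightarrow> bool" where
  "L2_orthonormal_basis \<mu> I e \<longleftrightarrow>
     (\<forall>i\<in>I. e i \<in> L2_space \<mu>) \<and>
     (\<forall>i\<in>I. \<forall>j\<in>I. L2_inner \<mu> (e i) (e j) = (if i = j then 1 else 0)) \<and>
     (\<forall>f\<in>L2_space \<mu>. \<forall>\<epsilon>>0. \<exists>F c. finite F \<and> F \<subseteq> I \<and>
        L2_norm \<mu> (\<lambda>x. f x - (\<Sum>i\<in>F. c i * e i x)) < \<epsilon>)"

definition spectral_measure :: "real measure \<Rightarrow> bool" where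
  "spectral_measure \<mu> \<longleftrightarrow> real_distribution \<mu> \<and>
     (\<exists>\<Lambda> :: real set. L2_orthonormal_basis \<mu> \<Lambda>
        (\<lambda>l x. exp (2 * of_real pi * \<i> * of_real l * of_real x)))"

definition digit_set :: "nat \<Rightarrow> nat \<Rightarrow> nat \<Rightarrow> real set" where
  "digit_set N p i =
     (if i = 1 then real ` {0..<N} else (\<lambda>b. real p * b) ` real ` {0..<N})"

text \<open>
  Sequences are indexed from 0: \<open>\<omega> k\<close> stands for \<open>\<omega>\<^sub>k\<^sub>+\<^sub>1\<close>, whence the exponent \<open>Suc k\<close>.
\<close>

definition mu_omega :: "nat \<Rightarrow> nat \<Rightarrow> nat \<Rightarrow> (nat \<Rightarrow> nat) \<Rightarrow> real measure" where
  "mu_omega t N p \<omega> = infinite_convolution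
     (\<lambda>k. uniform_dirac ((\<lambda>b. inverse (real (t * N) ^ Suc k) * b) ` digit_set N p (\<omega> k)))"

end

theory Submission
  imports Defs
begin

text \<open>
  Write \<open>M = t N\<close>, \<open>m(x) = 1/N \<Sum>j<N. cis (2 \<pi> j x)\<close>, and \<open>c\<^sub>k \<in> {1, p}\<close> for the dilation of the \<open>k\<close>-th
  digit set, so that the Fourier transform of the measure is the product of the
  \<open>m (c\<^sub>k \<xi> / M\<^sup>k)\<close>. The first \<open>n\<close> factors have the spectrum
  \<open>L + M L + \<dots> + M\<^bsup>n-1\<^esup> L\<close> with \<open>L = t {0..<N}\<close>, and every element of it may be shifted by a
  multiple of \<open>M\<^sup>n\<close>. If for infinitely many \<open>n\<close> the transform of the rescaled tail is
  bounded below on at least one point of each coset of the integers, such shifts yield nested finite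
  spectra whose union is a spectrum of the limit, by dominated convergence in
  the identity \<open>\<Sum>\<lambda>. \<bar>F(\<xi> + \<lambda>)\<bar>\<^sup>2 = 1\<close> for the transforms \<open>F\<close>. By compactness the lower
  bound reduces to an arithmetic question about the zeros \<open>M\<^bsup>k-1\<^esup> t a / c\<^sub>k\<close>, \<open>N\<close> not dividing \<open>a\<close>: for \<open>t \<ge> 2\<close> no coset of the
  integers consists of zeros, and for \<open>t = 1\<close> this holds for the tails that start with the symbol 1.
  The constant sequence 2 gives a dilate of the measure of the constant sequence 1.

  If \<open>t = 1\<close> and the last 1 is at position \<open>n\<close>, the measure is a discrete one convolved with the uniform
  distribution on \<open>[0, p N\<^bsup>-n\<^esup>]\<close>. Its restriction to the second interval of length
  \<open>N\<^bsup>-n\<^esup>\<close> is a translate of its restriction to the first one, multiplied by some \<open>r > 1\<close>.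
  The Fourier coefficients of the two indicators differ by the factor \<open>r\<close> and their squared norms
  by \<open>r\<close> too, so Parseval's identity would give \<open>r\<^sup>2 = r\<close>.
\<close>

section \<open>Orthonormal bases of \<open>L\<^sup>2\<close>\<close>

lemma L2_space_scale: "f \<in> L2_space M \<Longrightarrow> (\<lambda>x. c * f x) \<in> L2_space M"
  by (auto simp: L2_space_def norm_mult power_mult_distrib)

lemma norm_add_sq_le: "(norm (x + y))\<^sup>2 \<le> 2 * (norm x)\<^sup>2 + 2 * (norm y)\<^sup>2"
  for x y :: "'a::real_normed_vector"
proof -
  have "(norm (x + y))\<^sup>2 \<le> (norm x + norm y)\<^sup>2"
    by (intro power_mono norm_triangle_ineq) auto
  also have "\<dots> \<le> 2 * (norm x)\<^sup>2 + 2 * (norm y)\<^sup>2"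
    using sum_squares_bound[of "norm x" "norm y"] by (simp add: power2_sum)
  finally show ?thesis .
qed

lemma L2_space_add:
  assumes "f \<in> L2_space M" "g \<in> L2_space M"
  shows "(\<lambda>x. f x + g x) \<in> L2_space M"
proof -
  have [measurable]: "f \<in> borel_measurable M" "g \<in> borel_measurable M"
    and i: "integrable M (\<lambda>x. (cmod (f x))\<^sup>2)" "integrable M (\<lambda>x. (cmod (g x))\<^sup>2)"
    using assms by (auto simp: L2_space_def)
  have "integrable M (\<lambda>x. 2 * (cmod (f x))\<^sup>2 + 2 * (cmod (g x))\<^sup>2)"
    using i by simp
  then have "integrable M (\<lambda>x. (cmod (f x + g x))\<^sup>2)"
    by (rule Bochner_Integration.integrable_bound) (auto intro!: AE_I2 norm_add_sq_le)
  then show ?thesis by (simp add: L2_space_def)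
qed

lemma L2_space_diff:
  assumes "f \<in> L2_space M" "g \<in> L2_space M"
  shows "(\<lambda>x. f x - g x) \<in> L2_space M"
  using L2_space_add[OF assms(1) L2_space_scale[OF assms(2), of "-1"]] by simp

lemma L2_space_sum:
  assumes "\<And>i. i \<in> F \<Longrightarrow> e i \<in> L2_space M"
  shows "(\<lambda>x. \<Sum>i\<in>F. c i * e i x) \<in> L2_space M"
  using assms
proof (induction F rule: infinite_finite_induct)
  case (insert i F)
  then show ?case
    using L2_space_add[of "\<lambda>x. c i * e i x" M "\<lambda>x. \<Sum>i\<in>F. c i * e i x"]
    by (simp add: L2_space_scale)
qed (auto simp: L2_space_def)

lemma L2_integrable_mult_cnj:
  assumes "f \<in> L2_space M" "g \<in> L2_space M"
  shows "integrable M (\<lambda>x. f x * cnj (g x))"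
proof -
  have [measurable]: "f \<in> borel_measurable M" "g \<in> borel_measurable M"
    and i: "integrable M (\<lambda>x. (cmod (f x))\<^sup>2)" "integrable M (\<lambda>x. (cmod (g x))\<^sup>2)"
    using assms by (auto simp: L2_space_def)
  have "cmod a * cmod b \<le> (cmod a)\<^sup>2 + (cmod b)\<^sup>2" for a b
  proof -
    have "0 \<le> cmod a * cmod b" "2 * (cmod a * cmod b) \<le> (cmod a)\<^sup>2 + (cmod b)\<^sup>2"
      using sum_squares_bound[of "cmod a" "cmod b"] by (simp_all add: mult.assoc)
    then show ?thesis by linarith
  qed
  moreover have "integrable M (\<lambda>x. (cmod (f x))\<^sup>2 + (cmod (g x))\<^sup>2)"
    using i by simp
  moreover have "(\<lambda>x. f x * cnj (g x)) \<in> borel_measurable M"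
    by (intro borel_measurable_times borel_measurable_continuous_on[of cnj] continuous_intros) measurable
  ultimately show ?thesis
    by (elim Bochner_Integration.integrable_bound)
       (auto intro!: AE_I2 simp: norm_mult)
qed

lemma L2_inner_diff_scale_left:
  assumes "f \<in> L2_space M" "g \<in> L2_space M" "h \<in> L2_space M"
  shows "L2_inner M (\<lambda>x. f x - c * g x) h = L2_inner M f h - c * L2_inner M g h"
  using L2_integrable_mult_cnj[OF assms(1,3)] L2_integrable_mult_cnj[OF assms(2,3)]
  by (simp add: L2_inner_def left_diff_distrib mult.assoc)

text \<open>Completing the square in \<open>c\<close>: the last term measures how far
  \<open>c\<close> is from the Fourier coefficient of \<open>f\<close> at \<open>g\<close>.\<close>

lemma integral_norm_sq_diff_scale:
  assumes "f \<in> L2_space M" "g \<in> L2_space M" "L2_inner M g g = 1"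
  shows "(\<integral>x. (cmod (f x - c * g x))\<^sup>2 \<partial>M) =
    (\<integral>x. (cmod (f x))\<^sup>2 \<partial>M) - (cmod (L2_inner M f g))\<^sup>2 + (cmod (c - L2_inner M f g))\<^sup>2"
proof -
  have i: "integrable M (\<lambda>x. (cmod (f x))\<^sup>2)" "integrable M (\<lambda>x. (cmod (g x))\<^sup>2)"
    using assms by (auto simp: L2_space_def)
  have g1: "(\<integral>x. (cmod (g x))\<^sup>2 \<partial>M) = 1"
  proof -
    have "complex_of_real (\<integral>x. (cmod (g x))\<^sup>2 \<partial>M) = L2_inner M g g"
      unfolding L2_inner_def integral_complex_of_real[symmetric]
      by (intro Bochner_Integration.integral_cong) (auto simp: complex_norm_square[symmetric])
    then show ?thesis using assms(3) by simp
  qed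
  have ifg: "integrable M (\<lambda>x. cnj c * (f x * cnj (g x)))"
    using L2_integrable_mult_cnj[OF assms(1,2)] by simp
  define u where "u x = cnj c * (f x * cnj (g x))" for x
  have iu: "integrable M (\<lambda>x. Re (u x))"
    using integrable_Re[OF ifg] by (simp only: u_def)
  have "(cmod (f x - c * g x))\<^sup>2 =
      (cmod (f x))\<^sup>2 + (cmod c)\<^sup>2 * (cmod (g x))\<^sup>2 - 2 * Re (u x)" for x
    unfolding cmod_power2 u_def by (simp add: algebra_simps power2_eq_square)
  then have "(\<integral>x. (cmod (f x - c * g x))\<^sup>2 \<partial>M) =
      (\<integral>x. (cmod (f x))\<^sup>2 \<partial>M) + (cmod c)\<^sup>2 - 2 * (\<integral>x. Re (u x) \<partial>M)"
    using i iu g1 by simp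
  also have "(\<integral>x. Re (u x) \<partial>M) = Re (cnj c * L2_inner M f g)"
    unfolding u_def integral_Re[OF ifg] L2_inner_def by simp
  finally show ?thesis
    unfolding cmod_power2 by (simp add: algebra_simps power2_eq_square)
qed

text \<open>Subtracting one term leaves the Fourier coefficients at the other \<open>e i\<close>
  unchanged, by orthogonality, so induction reduces the claim to a single function. Arbitrary
  coefficients \<open>c\<close> are allowed so that the identity yields both Bessel's inequality and
  a lower bound for every approximation error.\<close>

lemma L2_pythagoras:
  assumes "f \<in> L2_space M" "finite F" "\<And>i. i \<in> F \<Longrightarrow> e i \<in> L2_space M"
    "\<And>i j. i \<in> F \<Longrightarrow> j \<in> F \<Longrightarrow> L2_inner M (e i) (e j) = (if i = j then 1 else 0)"
  shows "(\<integral>x. (cmod (f x - (\<Sum>i\<in>F. c i * e i x)))\<^sup>2 \<partial>M) =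
    (\<integral>x. (cmod (f x))\<^sup>2 \<partial>M) - (\<Sum>i\<in>F. (cmod (L2_inner M f (e i)))\<^sup>2)
      + (\<Sum>i\<in>F. (cmod (c i - L2_inner M f (e i)))\<^sup>2)"
  using assms(2,1,3,4)
proof (induction F arbitrary: f)
  case (insert j F)
  let ?g = "\<lambda>x. f x - c j * e j x"
  have g: "?g \<in> L2_space M"
    using insert by (intro L2_space_diff L2_space_scale) auto
  have *: "L2_inner M ?g (e i) = L2_inner M f (e i)" if "i \<in> F" for i
    using insert that by (subst L2_inner_diff_scale_left) auto
  have "(\<integral>x. (cmod (f x - (\<Sum>i\<in>insert j F. c i * e i x)))\<^sup>2 \<partial>M) =
      (\<integral>x. (cmod (?g x - (\<Sum>i\<in>F. c i * e i x)))\<^sup>2 \<partial>M)"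
    using insert by (simp add: algebra_simps)
  also have "\<dots> = (\<integral>x. (cmod (?g x))\<^sup>2 \<partial>M) - (\<Sum>i\<in>F. (cmod (L2_inner M ?g (e i)))\<^sup>2)
      + (\<Sum>i\<in>F. (cmod (c i - L2_inner M ?g (e i)))\<^sup>2)"
    using insert g by (intro insert.IH) auto
  finally show ?case
    using insert * by (simp add: integral_norm_sq_diff_scale)
qed simp

text \<open>Closeness is expressed by the squared norm, to which \<open>L2_pythagoras\<close>
  applies directly.\<close>

definition L2_span_closure ::
  "real measure \<Rightarrow> 'i set \<Rightarrow> ('i \<Rightarrow> real \<Rightarrow> complex) \<Rightarrow> (real \<Rightarrow> complex) set" where
  "L2_span_closure M I e = {f \<in> L2_space M. \<forall>\<epsilon>>0. \<exists>F c. finite F \<and> F \<subseteq> I \<and>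
     (\<integral>x. (cmod (f x - (\<Sum>i\<in>F. c i * e i x)))\<^sup>2 \<partial>M) < \<epsilon>}"

lemma L2_orthonormal_basisI:
  assumes "\<And>i. i \<in> I \<Longrightarrow> e i \<in> L2_space M"
    "\<And>i j. i \<in> I \<Longrightarrow> j \<in> I \<Longrightarrow> L2_inner M (e i) (e j) = (if i = j then 1 else 0)"
    "L2_space M \<subseteq> L2_span_closure M I e"
  shows "L2_orthonormal_basis M I e"
  unfolding L2_orthonormal_basis_def
proof (intro conjI ballI allI impI)
  fix f and \<epsilon> :: real assume "f \<in> L2_space M" "\<epsilon> > 0"
  then have "f \<in> L2_span_closure M I e" "\<epsilon>\<^sup>2 > 0"
    using assms(3) by auto
  then obtain F c where "finite F" "F \<subseteq> I"
      "(\<integral>x. (cmod (f x - (\<Sum>i\<in>F. c i * e i x)))\<^sup>2 \<partial>M) < \<epsilon>\<^sup>2"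
    unfolding L2_span_closure_def by blast
  then show "\<exists>F c. finite F \<and> F \<subseteq> I \<and> L2_norm M (\<lambda>x. f x - (\<Sum>i\<in>F. c i * e i x)) < \<epsilon>"
    unfolding L2_norm_def using \<open>\<epsilon> > 0\<close>
    by (intro exI[of _ F] exI[of _ c]) (simp add: real_less_lsqrt)
qed (use assms in auto)

lemma integral_norm_add_sq_le:
  assumes "f \<in> L2_space M" "g \<in> L2_space M"
  shows "(\<integral>x. (cmod (f x + g x))\<^sup>2 \<partial>M) \<le>
    2 * (\<integral>x. (cmod (f x))\<^sup>2 \<partial>M) + 2 * (\<integral>x. (cmod (g x))\<^sup>2 \<partial>M)"
proof -
  have "(\<integral>x. (cmod (f x + g x))\<^sup>2 \<partial>M) \<le> (\<integral>x. 2 * (cmod (f x))\<^sup>2 + 2 * (cmod (g x))\<^sup>2 \<partial>M)"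
    using assms L2_space_add[OF assms]
    by (intro integral_mono norm_add_sq_le) (auto simp: L2_space_def)
  then show ?thesis using assms by (simp add: L2_space_def)
qed

context
  fixes M I and e :: "'i \<Rightarrow> real \<Rightarrow> complex"
  assumes e: "e ` I \<subseteq> L2_space M"
begin

lemma L2_span_closure_add:
  assumes "f \<in> L2_span_closure M I e" "g \<in> L2_span_closure M I e"
  shows "(\<lambda>x. f x + g x) \<in> L2_span_closure M I e"
proof -
  have fg: "f \<in> L2_space M" "g \<in> L2_space M"
    using assms by (auto simp: L2_span_closure_def)
  show ?thesis unfolding L2_span_closure_def
  proof (intro CollectI conjI allI impI L2_space_add fg)
    fix \<epsilon> :: real assume "\<epsilon> > 0"
    then have "\<epsilon> / 4 > 0" by simp
    then obtain F c G d where *: "finite F" "F \<subseteq> I" "finite G" "G \<subseteq> I"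
       "(\<integral>x. (cmod (f x - (\<Sum>i\<in>F. c i * e i x)))\<^sup>2 \<partial>M) < \<epsilon> / 4"
       "(\<integral>x. (cmod (g x - (\<Sum>i\<in>G. d i * e i x)))\<^sup>2 \<partial>M) < \<epsilon> / 4"
      using assms unfolding L2_span_closure_def by blast
    \<comment> \<open>On the overlap of \<open>F\<close> and \<open>G\<close> the two coefficients
      add up.\<close>
    define h where "h i = (if i \<in> F then c i else 0) + (if i \<in> G then d i else 0)" for i
    have h: "(\<Sum>i\<in>F \<union> G. h i * e i x) = (\<Sum>i\<in>F. c i * e i x) + (\<Sum>i\<in>G. d i * e i x)" for x
    proof -
      have "(\<Sum>i\<in>F \<union> G. (if i \<in> F then c i else 0) * e i x) = (\<Sum>i\<in>F. c i * e i x)"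
           "(\<Sum>i\<in>F \<union> G. (if i \<in> G then d i else 0) * e i x) = (\<Sum>i\<in>G. d i * e i x)"
        using * by (auto intro!: sum.mono_neutral_cong_right)
      then show ?thesis by (simp add: h_def distrib_right sum.distrib)
    qed
    have "(\<integral>x. (cmod (f x + g x - (\<Sum>i\<in>F \<union> G. h i * e i x)))\<^sup>2 \<partial>M) =
        (\<integral>x. (cmod ((f x - (\<Sum>i\<in>F. c i * e i x)) + (g x - (\<Sum>i\<in>G. d i * e i x))))\<^sup>2 \<partial>M)"
      unfolding h by (simp add: algebra_simps)
    also have "\<dots> \<le> 2 * (\<integral>x. (cmod (f x - (\<Sum>i\<in>F. c i * e i x)))\<^sup>2 \<partial>M)
        + 2 * (\<integral>x. (cmod (g x - (\<Sum>i\<in>G. d i * e i x)))\<^sup>2 \<partial>M)"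
      using fg * e by (intro integral_norm_add_sq_le L2_space_diff L2_space_sum) auto
    also have "\<dots> < \<epsilon>" using * by simp
    finally show "\<exists>F c. finite F \<and> F \<subseteq> I \<and>
        (\<integral>x. (cmod (f x + g x - (\<Sum>i\<in>F. c i * e i x)))\<^sup>2 \<partial>M) < \<epsilon>"
      using * by (intro exI[of _ "F \<union> G"] exI[of _ h]) auto
  qed
qed

lemma L2_span_closure_scale:
  assumes "f \<in> L2_span_closure M I e"
  shows "(\<lambda>x. a * f x) \<in> L2_span_closure M I e"
  unfolding L2_span_closure_def
proof (intro CollectI conjI allI impI L2_space_scale)
  show f: "f \<in> L2_space M" using assms by (simp add: L2_span_closure_def)
  fix \<epsilon> :: real assume \<epsilon>: "\<epsilon> > 0"
  \<comment> \<open>The summand 1 in the denominator covers the case \<open>a = 0\<close>.\<close>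
  then have "\<epsilon> / ((cmod a)\<^sup>2 + 1) > 0" by (simp add: add_nonneg_pos)
  then obtain F c where *: "finite F" "F \<subseteq> I"
       "(\<integral>x. (cmod (f x - (\<Sum>i\<in>F. c i * e i x)))\<^sup>2 \<partial>M) < \<epsilon> / ((cmod a)\<^sup>2 + 1)"
    using assms unfolding L2_span_closure_def by blast
  have "(cmod (a * f x - (\<Sum>i\<in>F. (a * c i) * e i x)))\<^sup>2 =
      (cmod a)\<^sup>2 * (cmod (f x - (\<Sum>i\<in>F. c i * e i x)))\<^sup>2" for x
  proof -
    have "a * f x - (\<Sum>i\<in>F. (a * c i) * e i x) = a * (f x - (\<Sum>i\<in>F. c i * e i x))"
      by (simp add: right_diff_distrib sum_distrib_left mult.assoc)
    then show ?thesis by (simp add: norm_mult power_mult_distrib)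
  qed
  then have "(\<integral>x. (cmod (a * f x - (\<Sum>i\<in>F. (a * c i) * e i x)))\<^sup>2 \<partial>M) =
      (cmod a)\<^sup>2 * (\<integral>x. (cmod (f x - (\<Sum>i\<in>F. c i * e i x)))\<^sup>2 \<partial>M)"
    by simp
  also have "\<dots> \<le> ((cmod a)\<^sup>2 + 1) * (\<integral>x. (cmod (f x - (\<Sum>i\<in>F. c i * e i x)))\<^sup>2 \<partial>M)"
    by (intro mult_right_mono) auto
  also have "\<dots> < \<epsilon>"
    using *(3) by (subst (asm) pos_less_divide_eq) (simp_all add: add_nonneg_pos mult.commute)
  finally show "\<exists>F c. finite F \<and> F \<subseteq> I \<and>
      (\<integral>x. (cmod (a * f x - (\<Sum>i\<in>F. c i * e i x)))\<^sup>2 \<partial>M) < \<epsilon>"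
    using * by (intro exI[of _ F] exI[of _ "\<lambda>i. a * c i"]) auto
qed

lemma L2_span_closure_limit:
  assumes f: "f \<in> L2_space M"
    and g: "\<And>\<epsilon>. \<epsilon> > 0 \<Longrightarrow> \<exists>g\<in>L2_span_closure M I e. (\<integral>x. (cmod (f x - g x))\<^sup>2 \<partial>M) < \<epsilon>"
  shows "f \<in> L2_span_closure M I e"
  unfolding L2_span_closure_def
proof (intro CollectI conjI allI impI f)
  fix \<epsilon> :: real assume "\<epsilon> > 0"
  then have \<epsilon>: "\<epsilon> / 4 > 0" by simp
  obtain g where g: "g \<in> L2_span_closure M I e" "(\<integral>x. (cmod (f x - g x))\<^sup>2 \<partial>M) < \<epsilon> / 4"
    using g[OF \<epsilon>] by blast
  obtain F c where *: "finite F" "F \<subseteq> I"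
       "(\<integral>x. (cmod (g x - (\<Sum>i\<in>F. c i * e i x)))\<^sup>2 \<partial>M) < \<epsilon> / 4"
    using g(1) \<epsilon> unfolding L2_span_closure_def by blast
  have "g \<in> L2_space M" using g by (simp add: L2_span_closure_def)
  have "(\<integral>x. (cmod (f x - (\<Sum>i\<in>F. c i * e i x)))\<^sup>2 \<partial>M) =
      (\<integral>x. (cmod ((f x - g x) + (g x - (\<Sum>i\<in>F. c i * e i x))))\<^sup>2 \<partial>M)"
    by (simp add: algebra_simps)
  also have "\<dots> \<le> 2 * (\<integral>x. (cmod (f x - g x))\<^sup>2 \<partial>M)
      + 2 * (\<integral>x. (cmod (g x - (\<Sum>i\<in>F. c i * e i x)))\<^sup>2 \<partial>M)"
    using f \<open>g \<in> L2_space M\<close> * e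
    by (intro integral_norm_add_sq_le L2_space_diff L2_space_sum) auto
  also have "\<dots> < \<epsilon>" using g * by simp
  finally show "\<exists>F c. finite F \<and> F \<subseteq> I \<and>
      (\<integral>x. (cmod (f x - (\<Sum>i\<in>F. c i * e i x)))\<^sup>2 \<partial>M) < \<epsilon>"
    using * by blast
qed

lemma L2_span_closure_LIMSEQ:
  assumes f: "f \<in> L2_space M" and g: "\<And>n. g n \<in> L2_span_closure M I e"
    and lim: "(\<lambda>n. \<integral>x. (cmod (f x - g n x))\<^sup>2 \<partial>M) \<longlonglongrightarrow> 0"
  shows "f \<in> L2_span_closure M I e"
proof (rule L2_span_closure_limit[OF f])
  fix \<epsilon> :: real assume "\<epsilon> > 0"
  then have "eventually (\<lambda>n. (\<integral>x. (cmod (f x - g n x))\<^sup>2 \<partial>M) < \<epsilon>) sequentially"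
    using lim by (auto dest: order_tendstoD)
  then show "\<exists>g\<in>L2_span_closure M I e. (\<integral>x. (cmod (f x - g x))\<^sup>2 \<partial>M) < \<epsilon>"
    using g by (auto simp: eventually_sequentially)
qed

lemma L2_span_closure_sum:
  assumes "\<And>j. j \<in> J \<Longrightarrow> f j \<in> L2_span_closure M I e"
  shows "(\<lambda>x. \<Sum>j\<in>J. f j x) \<in> L2_span_closure M I e"
proof -
  have 0: "(\<lambda>x. 0) \<in> L2_span_closure M I e"
    by (auto simp: L2_span_closure_def L2_space_def intro!: exI[of _ "{}"])
  show ?thesis using assms
  proof (induction J rule: infinite_finite_induct)
    case (insert j J)
    then show ?case using L2_span_closure_add[of "f j" "\<lambda>x. \<Sum>j\<in>J. f j x"] by simp
  qed (use 0 in auto)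
qed

end

section \<open>Approximation by trigonometric polynomials with arbitrary real frequencies\<close>

inductive_set trig_polynomial :: "(real \<Rightarrow> complex) set" where
  cis: "(\<lambda>x. cis (a * x)) \<in> trig_polynomial"
| add: "f \<in> trig_polynomial \<Longrightarrow> g \<in> trig_polynomial \<Longrightarrow> (\<lambda>x. f x + g x) \<in> trig_polynomial"
| scale: "f \<in> trig_polynomial \<Longrightarrow> (\<lambda>x. c * f x) \<in> trig_polynomial"

lemma trig_polynomial_mult:
  assumes "f \<in> trig_polynomial" "g \<in> trig_polynomial"
  shows "(\<lambda>x. f x * g x) \<in> trig_polynomial"
  using assms(1)
proof induction
  case (cis a)
  show ?case using assms(2)
  proof induction
    case (cis b)
    then show ?case
      using trig_polynomial.cis[of "a + b"] by (simp add: cis_mult algebra_simps)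
  next
    case (scale f c)
    then show ?case using trig_polynomial.scale[of _ c] by (simp add: algebra_simps)
  qed (auto simp: distrib_left intro: trig_polynomial.add)
qed (auto simp: distrib_right mult.assoc intro: trig_polynomial.add trig_polynomial.scale)

lemma trig_polynomial_const: "(\<lambda>x. c) \<in> trig_polynomial"
  using trig_polynomial.scale[OF trig_polynomial.cis[of 0], of c] by simp

lemma trig_polynomial_continuous:
  "f \<in> trig_polynomial \<Longrightarrow> continuous_on A f"
proof (induction rule: trig_polynomial.induct)
  case (cis a)
  then show ?case by (auto simp: cis_conv_exp intro!: continuous_intros)
qed (auto intro!: continuous_intros)

text \<open>Stone-Weierstrass for the algebra of real functions that are trigonometric polynomials
  when read as complex functions. Since the frequencies are arbitrary reals, no periodicity prevents
  the separation of points.\<close>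

lemma trig_polynomial_uniformly_dense:
  fixes f :: "real \<Rightarrow> real"
  assumes "compact S" "continuous_on S f" "\<delta> > 0"
  obtains g where "g \<in> trig_polynomial" "\<And>x. x \<in> S \<Longrightarrow> cmod (of_real (f x) - g x) < \<delta>"
proof -
  let ?P = "\<lambda>g :: real \<Rightarrow> real. (\<lambda>x. complex_of_real (g x)) \<in> trig_polynomial"
  have "\<exists>g. ?P g \<and> (\<forall>x\<in>S. \<bar>f x - g x\<bar> < \<delta>)"
  proof (rule Stone_Weierstrass_HOL[OF assms(1)])
    fix g assume "?P g"
    then have "continuous_on S (\<lambda>x. Re (complex_of_real (g x)))"
      by (intro continuous_on_Re trig_polynomial_continuous)
    then show "continuous_on S g" by simp
  next
    fix x y :: real assume "x \<in> S \<and> y \<in> S \<and> x \<noteq> y"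
    \<comment> \<open>With this frequency \<open>sin (a * (z - y))\<close> is 0 at
      \<open>z = y\<close> and 1 at \<open>z = x\<close>.\<close>
    define a where "a = pi / (2 * (x - y))"
    have "of_real (sin (a * (z - y))) =
        (- (\<i> / 2) * cis (- (a * y))) * cis (a * z) + (\<i> / 2 * cis (a * y)) * cis ((- a) * z)" for z
    proof -
      have 1: "cis (- (a * y)) * cis (a * z) = cis (a * (z - y))"
        and 2: "cis (a * y) * cis ((- a) * z) = cis (- (a * (z - y)))"
        unfolding cis_mult by (simp_all add: algebra_simps)
      show ?thesis unfolding mult.assoc 1 2 by (simp add: complex_eq_iff)
    qed
    then have "?P (\<lambda>z. sin (a * (z - y)))"
      by (auto simp only: intro!: trig_polynomial.intros)
    moreover have "a * (x - y) = pi / 2"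
      using \<open>x \<in> S \<and> y \<in> S \<and> x \<noteq> y\<close> by (simp add: a_def field_simps)
    ultimately show "\<exists>f. ?P f \<and> f x \<noteq> f y"
      by (intro exI[of _ "\<lambda>z. sin (a * (z - y))"]) (simp only: sin_pi_half, simp)
  qed (use assms in \<open>auto intro: trig_polynomial_const trig_polynomial.add trig_polynomial_mult\<close>)
  then obtain g where "?P g" "\<And>x. x \<in> S \<Longrightarrow> \<bar>f x - g x\<bar> < \<delta>" by blast
  then show ?thesis
    using that[of "\<lambda>x. of_real (g x)"] by (simp flip: of_real_diff)
qed

lemma (in real_distribution) L2_spaceI_bounded:
  assumes [measurable]: "f \<in> borel_measurable borel" and "\<And>x. cmod (f x) \<le> B"
  shows "f \<in> L2_space M"
proof -
  have "(cmod (f x))\<^sup>2 \<le> B\<^sup>2" for x by (intro power_mono assms) auto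
  then show ?thesis
    by (auto simp: L2_space_def intro!: integrable_const_bound[where B="B\<^sup>2"] AE_I2)
qed

text \<open>Approximation by trigonometric polynomials on the compact support yields continuous functions,
  then half lines, then Borel sets.\<close>

lemma (in real_distribution) L2_span_closure_eq_L2_space:
  assumes bounded: "AE x in M. \<bar>x\<bar> \<le> R"
    and e: "e ` I \<subseteq> L2_space M"
    and cis: "\<And>a. (\<lambda>x. cis (a * x)) \<in> L2_span_closure M I e"
  shows "L2_space M \<subseteq> L2_span_closure M I e"
proof -
  let ?V = "L2_span_closure M I e"
  note add = L2_span_closure_add[where I=I and e=e, OF e] and scale = L2_span_closure_scale[where I=I and e=e, OF e]
    and limit = L2_span_closure_limit[where I=I and e=e, OF e] and seq = L2_span_closure_LIMSEQ[where I=I and e=e, OF e]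
    and sum = L2_span_closure_sum[where I=I and e=e, OF e]
  have trig: "g \<in> ?V" if "g \<in> trig_polynomial" for g
    using that by induction (auto intro: cis add scale)
  have cont: "(\<lambda>x. complex_of_real (f x)) \<in> ?V"
    if f: "continuous_on UNIV f" "\<And>x. \<bar>f x\<bar> \<le> B" for f B
  proof (rule limit)
    have [measurable]: "f \<in> borel_measurable borel" using f(1) by (rule borel_measurable_continuous_onI)
    show "(\<lambda>x. complex_of_real (f x)) \<in> L2_space M"
      using f(2) by (intro L2_spaceI_bounded[where B=B]) auto
    fix \<epsilon> :: real assume \<epsilon>: "\<epsilon> > 0"
    have "compact {-R..R}" "continuous_on {-R..R} f" "sqrt (\<epsilon> / 2) > 0"
      using f \<epsilon> by (auto intro: continuous_on_subset)
    then obtain g where g: "g \<in> trig_polynomial"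
        "\<And>x. x \<in> {-R..R} \<Longrightarrow> cmod (of_real (f x) - g x) < sqrt (\<epsilon> / 2)"
      by (rule trig_polynomial_uniformly_dense) blast
    have "AE x in M. (cmod (of_real (f x) - g x))\<^sup>2 \<le> \<epsilon> / 2"
      using bounded
    proof eventually_elim
      case (elim x)
      then have "(cmod (of_real (f x) - g x))\<^sup>2 \<le> (sqrt (\<epsilon> / 2))\<^sup>2"
        by (intro power_mono less_imp_le[OF g(2)]) auto
      then show ?case using \<epsilon> by simp
    qed
    moreover have [measurable]: "g \<in> borel_measurable borel"
      using trig_polynomial_continuous[OF g(1)] by (rule borel_measurable_continuous_onI)
    ultimately have "(\<integral>x. (cmod (of_real (f x) - g x))\<^sup>2 \<partial>M) \<le> (\<integral>x. \<epsilon> / 2 \<partial>M)"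
      by (intro integral_mono_AE integrable_const_bound[where B="\<epsilon> / 2"])
        (use \<epsilon> in auto)
    also have "\<dots> < \<epsilon>" using \<epsilon> by (simp add: prob_space del: space_eq_univ)
    finally show "\<exists>g\<in>?V. (\<integral>x. (cmod (of_real (f x) - g x))\<^sup>2 \<partial>M) < \<epsilon>"
      using trig[OF g(1)] by blast
  qed
  have atMost: "(\<lambda>x. indicator {..a} x :: complex) \<in> ?V" for a
  proof (rule seq)
    \<comment> \<open>For positive \<open>n\<close> this is 1 up to \<open>a\<close>, falls linearly
      to 0 on an interval of length \<open>1 / n\<close>, and is 0 afterwards.\<close>
    define f where "f n x = max 0 (min 1 (1 - real n * (x - a)))" for n x
    have f: "\<bar>f n x\<bar> \<le> 1" for n x by (auto simp: f_def)
    have cont_f: "continuous_on UNIV (f n)" for n unfolding f_def by (intro continuous_intros)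
    then show "(\<lambda>x. complex_of_real (f n x)) \<in> ?V" for n using f by (rule cont)
    have [measurable]: "f n \<in> borel_measurable borel" for n
      using cont_f by (rule borel_measurable_continuous_onI)
    show "(\<lambda>x. indicator {..a} x :: complex) \<in> L2_space M"
      by (rule L2_spaceI_bounded[where B=1]) (auto simp: indicator_def)
    have "(\<lambda>n. \<integral>x. (cmod (indicator {..a} x - of_real (f n x)))\<^sup>2 \<partial>M) \<longlonglongrightarrow> (\<integral>x. 0 \<partial>M)"
    proof (rule integral_dominated_convergence[where w="\<lambda>_. 1"])
      show "AE x in M. (\<lambda>n. (cmod (indicator {..a} x - of_real (f n x)))\<^sup>2) \<longlonglongrightarrow> 0"
      proof (intro AE_I2 tendsto_eventually)
        fix x
        show "\<forall>\<^sub>F n in sequentially. (cmod (indicator {..a} x - of_real (f n x)))\<^sup>2 = 0"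
        proof (cases "x \<le> a")
          case True
          then have "f n x = 1" for n
            by (simp add: f_def max_def min_def mult_le_0_iff)
          then show ?thesis using True by simp
        next
          case False
          obtain m :: nat where "1 / (x - a) < m" using reals_Archimedean2 by blast
          then have "1 < real m * (x - a)" using False by (simp add: field_simps)
          moreover have "real m * (x - a) \<le> real n * (x - a)" if "n \<ge> m" for n
            using False that by (intro mult_right_mono) auto
          ultimately have "1 < real n * (x - a)" if "n \<ge> m" for n
            using that by (meson less_le_trans)
          then have "f n x = 0" if "n \<ge> m" for n
            using that by (force simp: f_def)
          then show ?thesis using False by (auto simp: eventually_sequentially intro!: exI[of _ m])
        qed
      qed
      have "cmod (indicator {..a} x - of_real (f n x)) \<le> 1" for n x
      proof -
        have "indicator {..a} x - of_real (f n x) = complex_of_real (indicator {..a} x - f n x)"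
          by (simp add: indicator_def)
        moreover have "\<bar>indicator {..a} x - f n x\<bar> \<le> 1"
          by (auto simp: indicator_def f_def)
        ultimately show ?thesis by (simp only: norm_of_real)
      qed
      then show "AE x in M. norm ((cmod (indicator {..a} x - of_real (f n x)))\<^sup>2) \<le> 1" for n
        by (intro AE_I2) (simp add: power_le_one)
    qed auto
    then show "(\<lambda>n. \<integral>x. (cmod (indicator {..a} x - of_real (f n x)))\<^sup>2 \<partial>M) \<longlonglongrightarrow> 0" by simp
  qed
  have borel: "(\<lambda>x. indicator A x :: complex) \<in> ?V" if "A \<in> sets borel" for A
  proof -
    have "Int_stable (range atMost :: real set set)"
      by (auto simp: Int_stable_def)
    moreover have "range atMost \<subseteq> Pow (UNIV :: real set)" by simp
    moreover have "A \<in> sigma_sets UNIV (range atMost)"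
      using that by (simp add: borel_eq_atMost)
    ultimately show ?thesis
    proof (induction rule: sigma_sets_induct_disjoint)
      case (basic A)
      then show ?case using atMost by auto
    next
      case empty
      then show ?case using scale[OF cis[of 0], of 0] by simp
    next
      case (compl A)
      then show ?case
        using add[OF cis[of 0] scale[OF compl(2), of "-1"]]
        by (simp add: indicator_compl[unfolded Compl_eq_Diff_UNIV] )
    next
      case (union A)
      have [measurable]: "A i \<in> sets borel" for i
        using union(2) by (auto simp: borel_eq_atMost)
      show ?case
      proof (rule seq)
        show "(\<lambda>x. indicator (\<Union> (range A)) x :: complex) \<in> L2_space M"
          by (rule L2_spaceI_bounded[where B=1]) (auto simp: indicator_def)
        show "(\<lambda>x. \<Sum>i<n. indicator (A i) x :: complex) \<in> ?V" for n
          by (intro sum union)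
        have eq: "(\<Sum>i<n. indicator (A i) x :: complex) = indicator (\<Union>i<n. A i) x" for n x
          using union(1) by (subst indicator_UN_disjoint)
            (auto simp: disjoint_family_on_def)
        have "(\<lambda>n. \<integral>x. (cmod (indicator (\<Union> (range A)) x - (\<Sum>i<n. indicator (A i) x)))\<^sup>2 \<partial>M)
            \<longlonglongrightarrow> (\<integral>x. 0 \<partial>M)"
          unfolding eq
        proof (rule integral_dominated_convergence[where w="\<lambda>_. 1"])
          show "AE x in M. (\<lambda>n. (cmod (indicator (\<Union> (range A)) x - indicator (\<Union>i<n. A i) x))\<^sup>2) \<longlonglongrightarrow> 0"
          proof (intro AE_I2 tendsto_eventually)
            fix x
            show "\<forall>\<^sub>F n in sequentially.
                (cmod (indicator (\<Union> (range A)) x - indicator (\<Union>i<n. A i) x))\<^sup>2 = 0"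
            proof (cases "x \<in> \<Union> (range A)")
              case True
              then obtain m where "x \<in> A m" by blast
              then show ?thesis
                by (auto simp: eventually_sequentially indicator_def intro!: exI[of _ "Suc m"])
            qed (auto simp: indicator_def)
          qed
          show "AE x in M. norm ((cmod (indicator (\<Union> (range A)) x - indicator (\<Union>i<n. A i) x))\<^sup>2) \<le> 1" for n
            by (intro AE_I2) (auto simp: indicator_def)
        qed auto
        then show "(\<lambda>n. \<integral>x. (cmod (indicator (\<Union> (range A)) x - (\<Sum>i<n. indicator (A i) x)))\<^sup>2 \<partial>M)
            \<longlonglongrightarrow> 0" by simp
      qed
    qed
  qed
  have simple: "f \<in> ?V" if f: "simple_function M f" for f
  proof -
    have "(\<lambda>x. \<Sum>y\<in>range f. y * indicator (f -` {y}) x) \<in> ?V"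
    proof (intro sum scale borel)
      fix y
      show "f -` {y} \<in> sets borel" using simple_functionD(2)[OF f, of "{y}"] by simp
    qed
    also have "(\<lambda>x. \<Sum>y\<in>range f. y * indicator (f -` {y}) x) = f"
    proof
      fix x
      have "finite (range f)" using simple_functionD(1)[OF f] by simp
      then have "(\<Sum>y\<in>range f. y * indicator (f -` {y}) x) = (\<Sum>y\<in>{f x}. y * indicator (f -` {y}) x)"
        by (intro sum.mono_neutral_right) (auto simp: indicator_def)
      then show "(\<Sum>y\<in>range f. y * indicator (f -` {y}) x) = f x" by simp
    qed
    finally show ?thesis .
  qed
  show ?thesis
  proof
    fix f assume f: "f \<in> L2_space M"
    then have [measurable]: "f \<in> borel_measurable M" and i: "integrable M (\<lambda>x. (cmod (f x))\<^sup>2)"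
      by (auto simp: L2_space_def)
    \<comment> \<open>Approximation relative to the base point 0 gives simple functions bounded by
      \<open>2 * cmod (f x)\<close>. The errors are then at most \<open>3 * cmod (f x)\<close>,
      whence the factor 9 in the dominating function.\<close>
    have "\<exists>s. (\<forall>n. simple_function M (s n)) \<and> (\<forall>x. (\<lambda>n. s n x) \<longlonglongrightarrow> f x) \<and>
        (\<forall>n x. cmod (s n x) \<le> 2 * cmod (f x))"
      using borel_measurable_implies_sequence_metric[of f M 0] by simp
    then obtain s where s: "\<And>n. simple_function M (s n)" "\<And>x. (\<lambda>n. s n x) \<longlonglongrightarrow> f x"
        "\<And>n x. cmod (s n x) \<le> 2 * cmod (f x)" by blast
    have [measurable]: "s n \<in> borel_measurable M" for n
      using s(1) by (rule borel_measurable_simple_function)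
    show "f \<in> ?V"
    proof (rule seq[OF f simple[OF s(1)]])
      have "(\<lambda>n. \<integral>x. (cmod (f x - s n x))\<^sup>2 \<partial>M) \<longlonglongrightarrow> (\<integral>x. 0 \<partial>M)"
      proof (rule integral_dominated_convergence[where w="\<lambda>x. 9 * (cmod (f x))\<^sup>2"])
        show "AE x in M. (\<lambda>n. (cmod (f x - s n x))\<^sup>2) \<longlonglongrightarrow> 0"
        proof (intro AE_I2)
          fix x
          have "(\<lambda>n. (cmod (f x - s n x))\<^sup>2) \<longlonglongrightarrow> (cmod (f x - f x))\<^sup>2"
            by (intro tendsto_intros s)
          then show "(\<lambda>n. (cmod (f x - s n x))\<^sup>2) \<longlonglongrightarrow> 0" by simp
        qed
        show "AE x in M. norm ((cmod (f x - s n x))\<^sup>2) \<le> 9 * (cmod (f x))\<^sup>2" for n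
        proof (intro AE_I2)
          fix x
          have "cmod (f x - s n x) \<le> 3 * cmod (f x)"
            using norm_triangle_ineq4[of "f x" "s n x"] s(3)[of n x] by simp
          then have "(cmod (f x - s n x))\<^sup>2 \<le> (3 * cmod (f x))\<^sup>2"
            by (intro power_mono) auto
          then show "norm ((cmod (f x - s n x))\<^sup>2) \<le> 9 * (cmod (f x))\<^sup>2"
            by (simp add: power_mult_distrib)
        qed
      qed (use i in auto)
      then show "(\<lambda>n. \<integral>x. (cmod (f x - s n x))\<^sup>2 \<partial>M) \<longlonglongrightarrow> 0" by simp
    qed
  qed
qed

section \<open>A criterion for spectrality in terms of the characteristic function\<close>

lemma exp_eq_cis: "exp (2 * of_real pi * \<i> * of_real l * of_real x) = cis (2 * pi * l * x)"
  by (simp add: cis_conv_exp mult_ac)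

lemma L2_inner_exp:
  "L2_inner M (\<lambda>x. exp (2 * of_real pi * \<i> * of_real l * of_real x))
     (\<lambda>x. exp (2 * of_real pi * \<i> * of_real l' * of_real x)) = char M (2 * pi * (l - l'))"
  unfolding L2_inner_def char_def exp_eq_cis cis_cnj cis_mult
  by (intro Bochner_Integration.integral_cong) (auto simp: cis_conv_exp algebra_simps)

text \<open>Inner products of exponentials are values of \<open>char M\<close> at frequency
  differences, so \<open>orth\<close> is orthogonality. The sums in \<open>complete\<close> are the
  Bessel sums of the exponential of frequency \<xi>, whose norm is 1; sums close to 1 put every
  exponential into the closed span, and boundedness of the support extends this to the whole
  space.\<close>

theorem spectral_measureI:
  fixes \<Lambda> :: "real set"
  assumes M: "real_distribution M" and bounded: "AE x in M. \<bar>x\<bar> \<le> R"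
    and orth: "\<And>l l'. l \<in> \<Lambda> \<Longrightarrow> l' \<in> \<Lambda> \<Longrightarrow> l \<noteq> l' \<Longrightarrow> char M (2 * pi * (l - l')) = 0"
    and complete: "\<And>\<xi> \<epsilon>. \<epsilon> > 0 \<Longrightarrow> \<exists>F. finite F \<and> F \<subseteq> \<Lambda> \<and>
      (\<Sum>l\<in>F. (cmod (char M (2 * pi * (\<xi> - l))))\<^sup>2) > 1 - \<epsilon>"
  shows "spectral_measure M"
proof -
  interpret real_distribution M by fact
  define e :: "real \<Rightarrow> real \<Rightarrow> complex"
    where "e = (\<lambda>l x. exp (2 * of_real pi * \<i> * of_real l * of_real x))"
  have e: "e l \<in> L2_space M" for l
    by (rule L2_spaceI_bounded[where B=1]) (auto simp: e_def exp_eq_cis cis_conv_exp)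
  have inner: "L2_inner M (e l) (e l') = char M (2 * pi * (l - l'))" for l l'
    unfolding e_def by (rule L2_inner_exp)
  have on: "L2_inner M (e l) (e l') = (if l = l' then 1 else 0)" if "l \<in> \<Lambda>" "l' \<in> \<Lambda>" for l l'
    using that orth by (auto simp: inner char_zero)
  have span: "e \<xi> \<in> L2_span_closure M \<Lambda> e" for \<xi>
    unfolding L2_span_closure_def
  proof (intro CollectI conjI allI impI e)
    fix \<epsilon> :: real assume "\<epsilon> > 0"
    then obtain F where F: "finite F" "F \<subseteq> \<Lambda>"
        "(\<Sum>l\<in>F. (cmod (char M (2 * pi * (\<xi> - l))))\<^sup>2) > 1 - \<epsilon>"
      using complete by blast
    \<comment> \<open>With the Fourier coefficients the last sum in \<open>L2_pythagoras\<close>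
      vanishes, and the error is exactly the defect in Bessel's inequality.\<close>
    define c where "c l = L2_inner M (e \<xi>) (e l)" for l
    have "(\<integral>x. (cmod (e \<xi> x - (\<Sum>l\<in>F. c l * e l x)))\<^sup>2 \<partial>M) =
        (\<integral>x. (cmod (e \<xi> x))\<^sup>2 \<partial>M) - (\<Sum>l\<in>F. (cmod (c l))\<^sup>2)"
    proof (subst L2_pythagoras)
      show "L2_inner M (e i) (e j) = (if i = j then 1 else 0)" if "i \<in> F" "j \<in> F" for i j
        using on that F by blast
    qed (use F e in \<open>auto simp: c_def\<close>)
    also have "\<dots> < \<epsilon>"
      using F(3) prob_space by (simp add: c_def inner) (simp add: e_def exp_eq_cis)
    finally show "\<exists>F c. finite F \<and> F \<subseteq> \<Lambda> \<and> (\<integral>x. (cmod (e \<xi> x - (\<Sum>l\<in>F. c l * e l x)))\<^sup>2 \<partial>M) < \<epsilon>"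
      using F by blast
  qed
  have "(\<lambda>x. cis (a * x)) \<in> L2_span_closure M \<Lambda> e" for a
    using span[of "a / (2 * pi)"] by (simp add: e_def exp_eq_cis)
  then have "L2_orthonormal_basis M \<Lambda> e"
    using on e by (intro L2_orthonormal_basisI L2_span_closure_eq_L2_space[OF bounded]) auto
  then show ?thesis
    unfolding spectral_measure_def e_def using M by blast
qed

section \<open>The mask polynomial\<close>

definition mask_poly :: "nat \<Rightarrow> real \<Rightarrow> complex" where
  "mask_poly N x = (\<Sum>j<N. cis (2 * pi * (real j * x))) / of_nat N"

lemma cis_2pi_mult_eq_1_iff: "cis (2 * pi * x) = 1 \<longleftrightarrow> x \<in> \<int>"
proof
  assume "cis (2 * pi * x) = 1"
  then have "cos (2 * pi * x) = 1" by (auto simp: complex_eq_iff)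
  then obtain k :: int where "2 * pi * x = of_int k * 2 * pi" by (auto simp: cos_one_2pi_int)
  then show "x \<in> \<int>" by simp
next
  assume "x \<in> \<int>"
  then show "cis (2 * pi * x) = 1" by (rule cis_multiple_2pi)
qed

lemma mask_poly_int: "N > 0 \<Longrightarrow> x \<in> \<int> \<Longrightarrow> mask_poly N x = 1"
  by (simp add: mask_poly_def cis_multiple_2pi)

lemma mask_poly_0 [simp]: "N > 0 \<Longrightarrow> mask_poly N 0 = 1"
  by (simp add: mask_poly_int)

lemma norm_mask_poly_le_1: "cmod (mask_poly N x) \<le> 1"
proof (cases "N = 0")
  case False
  have "cmod (\<Sum>j<N. cis (2 * pi * (real j * x))) \<le> real N"
    by (rule order_trans[OF norm_sum]) simp
  then show ?thesis using False by (simp add: mask_poly_def norm_divide)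
qed (simp add: mask_poly_def)

lemma mask_poly_add_int:
  assumes "k \<in> \<int>"
  shows "mask_poly N (x + k) = mask_poly N x"
proof -
  have "cis (2 * pi * (real j * (x + k))) = cis (2 * pi * (real j * x))" for j
    using assms by (simp add: ring_distribs flip: cis_mult)
  then show ?thesis by (simp add: mask_poly_def)
qed

text \<open>A chord of the unit circle is at most as long as its arc.\<close>

lemma norm_cis_diff_le: "cmod (cis a - cis b) \<le> \<bar>a - b\<bar>"
proof -
  have "cis a - cis b = cis b * (cis (a - b) - 1)"
    by (simp add: cis_mult right_diff_distrib)
  then have "cmod (cis a - cis b) = cmod (cis (a - b) - 1)" by (simp add: norm_mult)
  also have "\<dots> = 2 * \<bar>sin ((a - b) / 2)\<bar>"
    using dist_exp_i_1[of "a - b"] by (simp add: cis_conv_exp)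
  also have "\<dots> \<le> \<bar>a - b\<bar>" using abs_sin_x_le_abs_x[of "(a - b) / 2"] by simp
  finally show ?thesis .
qed

lemma mask_poly_lipschitz: "cmod (mask_poly N x - mask_poly N y) \<le> 2 * pi * N * \<bar>x - y\<bar>"
proof (cases "N = 0")
  case False
  have "cmod (\<Sum>j<N. cis (2 * pi * (real j * x)) - cis (2 * pi * (real j * y)))
      \<le> (\<Sum>j<N. 2 * pi * N * \<bar>x - y\<bar>)"
  proof (intro sum_norm_le)
    fix j assume "j \<in> {..<N}"
    have "cmod (cis (2 * pi * (real j * x)) - cis (2 * pi * (real j * y)))
        \<le> \<bar>2 * pi * (real j * x) - 2 * pi * (real j * y)\<bar>"
      by (rule norm_cis_diff_le)
    also have "\<dots> = 2 * pi * real j * \<bar>x - y\<bar>"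
      by (simp add: abs_mult mult.assoc flip: right_diff_distrib)
    also have "\<dots> \<le> 2 * pi * real N * \<bar>x - y\<bar>"
      using \<open>j \<in> {..<N}\<close> by (intro mult_right_mono mult_left_mono) auto
    finally show "cmod (cis (2 * pi * (real j * x)) - cis (2 * pi * (real j * y)))
        \<le> 2 * pi * N * \<bar>x - y\<bar>" .
  qed
  also have "\<dots> = real N * (2 * pi * N * \<bar>x - y\<bar>)" by simp
  finally show ?thesis
    using False by (simp add: mask_poly_def norm_divide divide_le_eq mult.commute
        flip: diff_divide_distrib sum_subtractf)
qed (simp add: mask_poly_def)

text \<open>The geometric sum in multiplied-out form, valid at integers too. It determines the zeros
  of the mask and later gives the refinement equation of the uniform distribution on an
  interval.\<close>

lemma mask_poly_geometric:
  "of_nat N * mask_poly N x * (cis (2 * pi * x) - 1) = cis (2 * pi * (real N * x)) - 1"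
proof (cases "N = 0")
  case False
  have "cis (2 * pi * (real j * x)) = cis (2 * pi * x) ^ j" for j
    unfolding Complex.DeMoivre by (simp add: algebra_simps)
  then show ?thesis
    using False by (simp add: mask_poly_def power_diff_1_eq mult.commute)
qed simp

lemma mask_poly_eq_0:
  assumes "N > 0" "real N * x \<in> \<int>" "x \<notin> \<int>"
  shows "mask_poly N x = 0"
proof -
  have "of_nat N * mask_poly N x * (cis (2 * pi * x) - 1) = 0"
    unfolding mask_poly_geometric using assms(2) by (simp add: cis_2pi_mult_eq_1_iff)
  then show ?thesis using assms by (simp add: cis_2pi_mult_eq_1_iff)
qed

lemma mask_poly_eq_0D:
  assumes "mask_poly N x = 0" "N > 0"
  shows "real N * x \<in> \<int>" "x \<notin> \<int>"
proof -
  show "x \<notin> \<int>" using mask_poly_int[of N x] assms by auto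
  show "real N * x \<in> \<int>"
    using mask_poly_geometric[of N x] assms by (simp add: cis_2pi_mult_eq_1_iff)
qed

text \<open>After expanding the squares and summing over \<open>d\<close> first, an off-diagonal
  pair \<open>j\<close>, \<open>k\<close> contributes a multiple of the mask at
  \<open>(j - k) * c / N\<close>. This point is not an integer because \<open>c\<close> is coprime
  to \<open>N\<close> and \<open>j - k\<close> is nonzero of size below \<open>N\<close>, so the
  mask vanishes there.\<close>

lemma sum_norm_mask_poly_sq:
  assumes "N > 0" "coprime c N"
  shows "(\<Sum>d<N. (cmod (mask_poly N (y + real c * real d / real N)))\<^sup>2) = 1"
proof -
  define w where "w j k d = cis (2 * pi * ((real j - real k) * (y + real c * real d / real N)))" for j k d
  have "complex_of_real ((cmod (mask_poly N (y + real c * real d / real N)))\<^sup>2) =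
      (\<Sum>j<N. \<Sum>k<N. w j k d) / of_nat (N\<^sup>2)" for d
  proof -
    have "complex_of_real ((cmod (mask_poly N x))\<^sup>2) =
        (\<Sum>j<N. \<Sum>k<N. cis (2 * pi * ((real j - real k) * x))) / of_nat (N\<^sup>2)" for x
      unfolding complex_norm_square mask_poly_def complex_cnj_divide cnj_sum cis_cnj times_divide_times_eq
        sum_product cis_mult by (simp add: power2_eq_square algebra_simps)
    then show ?thesis by (simp add: w_def)
  qed
  then have "complex_of_real (\<Sum>d<N. (cmod (mask_poly N (y + real c * real d / real N)))\<^sup>2) =
      (\<Sum>d<N. \<Sum>j<N. \<Sum>k<N. w j k d) / of_nat (N\<^sup>2)"
    by (simp add: sum_divide_distrib)
  also have "(\<Sum>d<N. \<Sum>j<N. \<Sum>k<N. w j k d) = (\<Sum>j<N. \<Sum>k<N. \<Sum>d<N. w j k d)"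
    by (simp add: sum.swap[where A="{..<N}" and g="\<lambda>d k. w _ k d"] sum.swap[where g="\<lambda>d j. \<Sum>k<N. w j k d"])
  also have "\<dots> = (\<Sum>j<N. \<Sum>k<N. if j = k then of_nat N else 0)"
  proof (intro sum.cong refl)
    fix j k assume jk: "j \<in> {..<N}" "k \<in> {..<N}"
    show "(\<Sum>d<N. w j k d) = (if j = k then of_nat N else 0)"
    proof (cases "j = k")
      case False
      define x where "x = (real j - real k) * real c / real N"
      have "(\<Sum>d<N. w j k d) =
          (\<Sum>d<N. cis (2 * pi * ((real j - real k) * y)) * cis (2 * pi * (real d * x)))"
        unfolding w_def cis_mult x_def by (simp add: algebra_simps)
      also have "\<dots> = cis (2 * pi * ((real j - real k) * y)) * (of_nat N * mask_poly N x)"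
        using assms by (simp add: mask_poly_def flip: sum_distrib_left)
      also have "mask_poly N x = 0"
      proof (rule mask_poly_eq_0[OF assms(1)])
        have "real N * x = of_int ((int j - int k) * int c)" using assms by (simp add: x_def)
        then show "real N * x \<in> \<int>" by (metis Ints_of_int)
        show "x \<notin> \<int>"
        proof
          assume "x \<in> \<int>"
          then obtain a where "x = of_int a" by (auto elim: Ints_cases)
          then have "of_int ((int j - int k) * int c) = (of_int (a * int N) :: real)"
            using assms by (simp add: x_def field_simps)
          then have "(int j - int k) * int c = a * int N" by (simp only: of_int_eq_iff)
          then have "int N dvd (int j - int k) * int c" by simp
          then have "int N dvd int j - int k"
            using assms(2) by (subst (asm) coprime_dvd_mult_left_iff) (auto simp: coprime_commute)
          then have "\<bar>int j - int k\<bar> \<ge> int N" using False zdvd_imp_le by (auto dest!: dvd_imp_le_int)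
          then show False using jk by auto
        qed
      qed
      finally show ?thesis using False by simp
    qed (simp add: w_def)
  qed
  also have "\<dots> = of_nat (N\<^sup>2)" by (simp add: power2_eq_square)
  finally have "complex_of_real (\<Sum>d<N. (cmod (mask_poly N (y + real c * real d / real N)))\<^sup>2) = 1"
    using assms by simp
  then show ?thesis by (simp only: of_real_eq_1_iff)
qed

section \<open>Spectra of the finite convolutions and of their limit\<close>

text \<open>Coprimality to \<open>N\<close> serves the finite spectra; the common bound
  \<open>p\<close> gives Lipschitz constants and supports independent of \<open>k\<close>. That the
  dilations take only the values 1 and \<open>p\<close> enters with the study of the zeros. The
  constant sequence 1 with \<open>p = 1\<close> is an instance as well.\<close>

locale moran =
  fixes t N p :: nat and c :: "nat \<Rightarrow> nat"
  assumes t: "t \<ge> 1" and N: "N \<ge> 2" and coprime: "\<And>k. coprime (c k) N" and c_le: "\<And>k. c k \<le> p"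
begin

definition M :: real where "M = real (t * N)"

definition factor :: "nat \<Rightarrow> real \<Rightarrow> complex" where
  "factor k \<xi> = mask_poly N (real (c k) * \<xi>)"

text \<open>\<open>head n\<close> is the Fourier transform of the convolution of the first \<open>n\<close> measures; \<open>tail n\<close> is
  that of the infinite convolution of the remaining ones, rescaled by \<open>M\<^sup>n\<close>.\<close>

definition head :: "nat \<Rightarrow> real \<Rightarrow> complex" where
  "head n \<xi> = (\<Prod>k<n. factor k (\<xi> / M ^ Suc k))"

definition tail :: "nat \<Rightarrow> real \<Rightarrow> complex" where
  "tail n \<xi> = (\<Prod>k. factor (n + k) (\<xi> / M ^ Suc k))"

text \<open>A Lipschitz constant shared by all factors: that of the mask times the largest possible
  dilation.\<close>

definition C :: real where "C = 2 * pi * N * p"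

lemma M: "M \<ge> 2" "M > 0" "M \<noteq> 0"
proof -
  have "1 * 2 \<le> t * N" using t N by (intro mult_mono) auto
  then show "M \<ge> 2" unfolding M_def by linarith
  then show "M > 0" "M \<noteq> 0" by auto
qed

lemma C: "C \<ge> 0" by (simp add: C_def)

lemma norm_factor_le_1: "cmod (factor k \<xi>) \<le> 1"
  by (simp add: factor_def norm_mask_poly_le_1)

lemma factor_0 [simp]: "factor k 0 = 1"
  using N by (simp add: factor_def)

lemma factor_lipschitz: "cmod (factor k x - factor k y) \<le> C * \<bar>x - y\<bar>"
proof -
  have "cmod (factor k x - factor k y) \<le> 2 * pi * N * (c k * \<bar>x - y\<bar>)"
    using mask_poly_lipschitz[of N "c k * x" "c k * y"]
    by (simp add: factor_def abs_mult flip: right_diff_distrib)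
  also have "\<dots> \<le> 2 * pi * N * (p * \<bar>x - y\<bar>)"
    using c_le[of k] by (intro mult_left_mono mult_right_mono) auto
  finally show ?thesis by (simp add: C_def mult.assoc)
qed

lemma sum_inverse_powers_le: "(\<Sum>k<n. 1 / M ^ Suc k) \<le> 1"
proof -
  have "(\<Sum>k<n. 1 / M ^ Suc k) \<le> (\<Sum>k<n. (1 / 2) ^ Suc k)"
    unfolding power_one_over[symmetric] using M
    by (intro sum_mono power_mono) (auto simp: field_simps)
  also have "\<dots> = 1 - (1 / 2) ^ n" by (induction n) simp_all
  also have "\<dots> \<le> 1" by simp
  finally show ?thesis .
qed

text \<open>All factors have norm at most 1, so the difference of the products is at most the sum of
  the differences; the powers of \<open>M\<close> make that sum bounded independently of
  \<open>n\<close>.\<close>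

lemma prod_factor_lipschitz:
  "cmod ((\<Prod>k<n. factor (m + k) (x / M ^ Suc k)) - (\<Prod>k<n. factor (m + k) (y / M ^ Suc k)))
     \<le> C * \<bar>x - y\<bar>"
proof -
  have "cmod ((\<Prod>k<n. factor (m + k) (x / M ^ Suc k)) - (\<Prod>k<n. factor (m + k) (y / M ^ Suc k)))
      \<le> (\<Sum>k<n. cmod (factor (m + k) (x / M ^ Suc k) - factor (m + k) (y / M ^ Suc k)))"
    by (intro norm_prod_diff norm_factor_le_1)
  also have "\<dots> \<le> (\<Sum>k<n. C * \<bar>x - y\<bar> * (1 / M ^ Suc k))"
  proof (intro sum_mono order_trans[OF factor_lipschitz])
    fix k
    have "\<bar>x / M ^ Suc k - y / M ^ Suc k\<bar> = \<bar>x - y\<bar> / M ^ Suc k"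
      using M by (simp add: abs_mult flip: diff_divide_distrib)
    then show "C * \<bar>x / M ^ Suc k - y / M ^ Suc k\<bar> \<le> C * \<bar>x - y\<bar> * (1 / M ^ Suc k)" by simp
  qed
  also have "\<dots> = C * \<bar>x - y\<bar> * (\<Sum>k<n. 1 / M ^ Suc k)" by (rule sum_distrib_left[symmetric])
  also have "\<dots> \<le> C * \<bar>x - y\<bar> * 1"
    using C by (intro mult_left_mono sum_inverse_powers_le) auto
  finally show ?thesis by simp
qed

text \<open>Since every factor is 1 at 0 and Lipschitz, its distance from 1 is bounded by a
  geometric sequence, so the product converges absolutely.\<close>

lemma tail_LIMSEQ: "(\<lambda>n. \<Prod>k<n. factor (m + k) (\<xi> / M ^ Suc k)) \<longlonglongrightarrow> tail m \<xi>"
proof -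
  have "summable (\<lambda>k. C * \<bar>\<xi>\<bar> / M * (1 / M) ^ k)"
    using M by (intro summable_mult summable_geometric) auto
  then have "summable (\<lambda>k. cmod (factor (m + k) (\<xi> / M ^ Suc k) - 1))"
  proof (rule summable_comparison_test')
    fix k
    have "cmod (factor (m + k) (\<xi> / M ^ Suc k) - factor (m + k) 0) \<le> C * \<bar>\<xi> / M ^ Suc k - 0\<bar>"
      by (rule factor_lipschitz)
    then show "norm (cmod (factor (m + k) (\<xi> / M ^ Suc k) - 1)) \<le> C * \<bar>\<xi>\<bar> / M * (1 / M) ^ k"
      using M by (simp add: abs_mult power_one_over)
  qed
  then have "convergent_prod (\<lambda>k. factor (m + k) (\<xi> / M ^ Suc k))"
    by (intro abs_convergent_prod_imp_convergent_prod summable_imp_abs_convergent_prod)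
  from convergent_prod_LIMSEQ[OF this] show ?thesis
    unfolding tail_def by (subst LIMSEQ_lessThan_iff_atMost)
qed

lemma head_LIMSEQ: "(\<lambda>n. head n \<xi>) \<longlonglongrightarrow> tail 0 \<xi>"
  using tail_LIMSEQ[of 0] by (simp add: head_def)

lemma tail_lipschitz: "cmod (tail m x - tail m y) \<le> C * \<bar>x - y\<bar>"
  by (rule LIMSEQ_le_const2[OF tendsto_norm[OF tendsto_diff[OF tail_LIMSEQ tail_LIMSEQ]]])
     (use prod_factor_lipschitz in blast)

lemma norm_prod_factor_le_1: "cmod (\<Prod>k<n. factor (m + k) (\<xi> / M ^ Suc k)) \<le> 1"
  unfolding prod_norm[symmetric] by (intro prod_le_1) (auto intro: norm_factor_le_1)

lemma norm_tail_le_1: "cmod (tail m \<xi>) \<le> 1"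
  by (rule LIMSEQ_le_const2[OF tendsto_norm[OF tail_LIMSEQ]]) (use norm_prod_factor_le_1 in blast)

lemma head_0 [simp]: "head n 0 = 1"
  by (simp add: head_def)

lemma head_Suc: "head (Suc n) \<xi> = head n \<xi> * factor n (\<xi> / M ^ Suc n)"
  by (simp add: head_def)

lemma tail_0 [simp]: "tail n 0 = 1"
  by (simp add: tail_def)

lemma tail_split:
  "tail m \<xi> = (\<Prod>k<n. factor (m + k) (\<xi> / M ^ Suc k)) * tail (m + n) (\<xi> / M ^ n)"
proof (rule LIMSEQ_unique)
  show "(\<lambda>j. \<Prod>k<j + n. factor (m + k) (\<xi> / M ^ Suc k)) \<longlonglongrightarrow> tail m \<xi>"
    using tail_LIMSEQ by (rule LIMSEQ_ignore_initial_segment)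
  have "(\<Prod>k<j + n. factor (m + k) (\<xi> / M ^ Suc k)) =
      (\<Prod>k<n. factor (m + k) (\<xi> / M ^ Suc k)) *
      (\<Prod>k<j. factor (m + n + k) (\<xi> / M ^ n / M ^ Suc k))" for j
  proof -
    have "(\<Prod>k<j + n. factor (m + k) (\<xi> / M ^ Suc k)) =
        (\<Prod>k<n. factor (m + k) (\<xi> / M ^ Suc k)) * (\<Prod>k=n..<j + n. factor (m + k) (\<xi> / M ^ Suc k))"
      unfolding lessThan_atLeast0 by (rule prod.atLeastLessThan_concat[symmetric]) auto
    also have "(\<Prod>k=n..<j + n. factor (m + k) (\<xi> / M ^ Suc k)) =
        (\<Prod>k<j. factor (m + n + k) (\<xi> / M ^ n / M ^ Suc k))"
      using prod.shift_bounds_nat_ivl[of "\<lambda>k. factor (m + k) (\<xi> / M ^ Suc k)" 0 n j]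
      by (simp add: lessThan_atLeast0 power_add algebra_simps)
    finally show ?thesis .
  qed
  then show "(\<lambda>j. \<Prod>k<j + n. factor (m + k) (\<xi> / M ^ Suc k)) \<longlonglongrightarrow>
      (\<Prod>k<n. factor (m + k) (\<xi> / M ^ Suc k)) * tail (m + n) (\<xi> / M ^ n)"
    by (simp only:) (intro tendsto_mult tendsto_const tail_LIMSEQ)
qed

lemma tail_0_split: "tail 0 \<xi> = head n \<xi> * tail n (\<xi> / M ^ n)"
  using tail_split[of 0 \<xi> n] by (simp add: head_def)

text \<open>For \<open>k < n\<close> the shift divided by \<open>M ^ Suc k\<close> is still an
  integer, and the mask has period 1. This is the freedom to move the elements of a finite
  spectrum.\<close>

lemma head_add_int:
  assumes "j \<in> \<int>"
  shows "head n (\<xi> + M ^ n * j) = head n \<xi>"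
  unfolding head_def
proof (intro prod.cong refl)
  fix k assume "k \<in> {..<n}"
  then have "M ^ n = M ^ (n - Suc k) * M ^ Suc k" by (subst power_add[symmetric]) simp
  then have "real (c k) * ((\<xi> + M ^ n * j) / M ^ Suc k) =
      real (c k) * (\<xi> / M ^ Suc k) + real (c k) * (M ^ (n - Suc k) * j)"
    using M by (simp add: field_simps)
  moreover have "real (c k) * (M ^ (n - Suc k) * j) \<in> \<int>"
    using assms by (simp add: M_def)
  ultimately show "factor k ((\<xi> + M ^ n * j) / M ^ Suc k) = factor k (\<xi> / M ^ Suc k)"
    unfolding factor_def by (simp only: mask_poly_add_int)
qed

text \<open>Parseval's identity for all exponentials at once. It contains both orthogonality and
  completeness, and it is the form that survives multiplication by a further factor.\<close>

definition spectrum_upto :: "nat \<Rightarrow> real set \<Rightarrow> bool" where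
  "spectrum_upto n L \<longleftrightarrow> finite L \<and> (\<forall>\<xi>. (\<Sum>l\<in>L. (cmod (head n (\<xi> + l)))\<^sup>2) = 1)"

text \<open>At \<open>\<xi> = - l'\<close> the summand of \<open>l'\<close> is already 1, so all
  others vanish.\<close>

lemma spectrum_upto_orthogonal:
  assumes "spectrum_upto n L" "l \<in> L" "l' \<in> L" "l \<noteq> l'"
  shows "head n (l - l') = 0"
proof -
  have L: "finite L" "(\<Sum>l\<in>L. (cmod (head n (- l' + l)))\<^sup>2) = 1"
    using assms(1) unfolding spectrum_upto_def by blast+
  then have "(\<Sum>l\<in>L - {l'}. (cmod (head n (- l' + l)))\<^sup>2) = 0"
    using assms(3) by (simp add: sum.remove)
  then have "(cmod (head n (- l' + l)))\<^sup>2 = 0"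
    using L(1) assms by (subst (asm) sum_nonneg_eq_0_iff) auto
  then show ?thesis by (simp add: add.commute)
qed

lemma spectrum_upto_0: "spectrum_upto 0 {0}"
  by (simp add: spectrum_upto_def head_def)

text \<open>Periodicity leaves each summand unchanged. Two elements cannot collide after shifting:
  \<open>head n\<close> would be 0 at their difference by orthogonality and 1 by
  periodicity.\<close>

lemma spectrum_upto_shift:
  assumes "spectrum_upto n L" "\<And>l. l \<in> L \<Longrightarrow> h l \<in> \<int>"
  shows "spectrum_upto n ((\<lambda>l. l + M ^ n * h l) ` L)"
proof -
  have inj: "inj_on (\<lambda>l. l + M ^ n * h l) L"
  proof (rule inj_onI, rule ccontr)
    fix l l' assume l: "l \<in> L" "l' \<in> L" "l + M ^ n * h l = l' + M ^ n * h l'" "l \<noteq> l'"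
    have "head n (l - l') = head n (l - l' + M ^ n * (h l - h l'))"
      using assms(2) l by (intro head_add_int[symmetric]) auto
    also have "l - l' + M ^ n * (h l - h l') = 0" using l(3) by (simp add: algebra_simps)
    finally show False using spectrum_upto_orthogonal[OF assms(1) l(1,2,4)] by simp
  qed
  have "(\<Sum>l\<in>(\<lambda>l. l + M ^ n * h l) ` L. (cmod (head n (\<xi> + l)))\<^sup>2) =
      (\<Sum>l\<in>L. (cmod (head n (\<xi> + l)))\<^sup>2)" for \<xi>
    using head_add_int[OF assms(2), of _ n "\<xi> + _"] unfolding sum.reindex[OF inj]
    by (intro sum.cong) (auto simp: add.assoc)
  then show ?thesis using assms(1) by (simp add: spectrum_upto_def)
qed

text \<open>Adding \<open>M ^ n * real (t * d)\<close> does not change \<open>head n\<close> and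
  moves the argument of the new factor, before dilation, by exactly \<open>d / N\<close>. Hence the
  sum over \<open>d\<close> is the mask identity and collapses to 1.\<close>

lemma spectrum_upto_Suc:
  assumes "spectrum_upto n L"
  shows "spectrum_upto (Suc n) ((\<lambda>(l, d). l + M ^ n * real (t * d)) ` (L \<times> {..<N}))"
proof -
  have inj: "inj_on (\<lambda>(l, d). l + M ^ n * real (t * d)) (L \<times> {..<N})"
  proof (rule inj_onI, clarify)
    fix l l' d d' assume l: "l \<in> L" "l' \<in> L"
      and eq: "l + M ^ n * real (t * d) = l' + M ^ n * real (t * d')"
    have "l = l'"
    proof (rule ccontr)
      assume "l \<noteq> l'"
      have "head n (l - l') = head n (l - l' + M ^ n * (real (t * d) - real (t * d')))"
        by (intro head_add_int[symmetric]) auto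
      also have "l - l' + M ^ n * (real (t * d) - real (t * d')) = 0"
        using eq by (simp add: algebra_simps)
      finally show False using spectrum_upto_orthogonal[OF assms l \<open>l \<noteq> l'\<close>] by simp
    qed
    then show "l = l' \<and> d = d'" using eq M t by simp
  qed
  have head: "head (Suc n) (\<xi> + (l + M ^ n * real (t * d))) =
      head n (\<xi> + l) * mask_poly N (real (c n) * (\<xi> + l) / M ^ Suc n + real (c n) * real d / real N)"
    for \<xi> l d
  proof -
    have "head n (\<xi> + (l + M ^ n * real (t * d))) = head n (\<xi> + l)"
      using head_add_int[of "real (t * d)" n "\<xi> + l"] by (simp add: add.assoc)
    moreover have "M ^ n * real (t * d) / M ^ Suc n = real d / real N"
      using M t by (simp add: M_def)
    then have "(\<xi> + (l + M ^ n * real (t * d))) / M ^ Suc n = (\<xi> + l) / M ^ Suc n + real d / real N"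
      by (simp add: add_divide_distrib)
    ultimately have "head (Suc n) (\<xi> + (l + M ^ n * real (t * d))) =
        head n (\<xi> + l) * factor n ((\<xi> + l) / M ^ Suc n + real d / real N)"
      unfolding head_Suc by (simp only:)
    then show ?thesis by (simp add: factor_def distrib_left)
  qed
  have "(\<Sum>l\<in>(\<lambda>(l, d). l + M ^ n * real (t * d)) ` (L \<times> {..<N}). (cmod (head (Suc n) (\<xi> + l)))\<^sup>2) = 1"
    for \<xi>
  proof -
    have "(\<Sum>l\<in>(\<lambda>(l, d). l + M ^ n * real (t * d)) ` (L \<times> {..<N}). (cmod (head (Suc n) (\<xi> + l)))\<^sup>2) =
        (\<Sum>l\<in>L. \<Sum>d<N. (cmod (head (Suc n) (\<xi> + (l + M ^ n * real (t * d)))))\<^sup>2)"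
      unfolding sum.reindex[OF inj] by (simp add: sum.cartesian_product case_prod_unfold o_def)
    also have "\<dots> = (\<Sum>l\<in>L. (cmod (head n (\<xi> + l)))\<^sup>2 *
        (\<Sum>d<N. (cmod (mask_poly N (real (c n) * (\<xi> + l) / M ^ Suc n + real (c n) * real d / real N)))\<^sup>2))"
      unfolding head norm_mult power_mult_distrib sum_distrib_left ..
    also have "\<dots> = (\<Sum>l\<in>L. (cmod (head n (\<xi> + l)))\<^sup>2)"
      using N coprime by (subst sum_norm_mask_poly_sq) auto
    finally show ?thesis using assms by (simp add: spectrum_upto_def)
  qed
  then show ?thesis using assms by (simp add: spectrum_upto_def)
qed

lemma spectrum_upto_extend:
  assumes "spectrum_upto n L" "n \<le> n'"
  shows "\<exists>L'. L \<subseteq> L' \<and> spectrum_upto n' L'"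
  using assms(2)
proof (induction rule: dec_induct)
  case (step m)
  then obtain L' where L': "L \<subseteq> L'" "spectrum_upto m L'" by blast
  \<comment> \<open>The digit \<open>d = 0\<close> keeps the old elements.\<close>
  have "l \<in> (\<lambda>(l, d). l + M ^ m * real (t * d)) ` (L' \<times> {..<N})" if "l \<in> L" for l
    using that L'(1) N by (intro image_eqI[of _ _ "(l, 0)"]) auto
  then show ?case using spectrum_upto_Suc[OF L'(2)] by blast
qed (use assms in blast)

text \<open>Passing to the limit in Parseval's identity could lose mass to elements of the growing
  spectra. The lower bound on the tails prevents this, since it bounds \<open>head\<close> by a
  constant multiple of the limit transform on those elements.\<close>

theorem spectrum_from_equipositive_tails:
  assumes "infinite S" "\<epsilon> > 0"
    and equipos: "\<And>n x. n \<in> S \<Longrightarrow> \<exists>j\<in>\<int>. cmod (tail n (x + j)) \<ge> \<epsilon>"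
  obtains \<Lambda> where "\<And>l l'. l \<in> \<Lambda> \<Longrightarrow> l' \<in> \<Lambda> \<Longrightarrow> l \<noteq> l' \<Longrightarrow> tail 0 (l - l') = 0"
    "\<And>\<xi> \<eta>. \<eta> > 0 \<Longrightarrow> \<exists>F. finite F \<and> F \<subseteq> \<Lambda> \<and> (\<Sum>l\<in>F. (cmod (tail 0 (\<xi> + l)))\<^sup>2) > 1 - \<eta>"
proof -
  \<comment> \<open>Elements that are kept unshifted get the lower bound 1/2, from
    \<open>tail n 0 = 1\<close> and continuity; hence the cap.\<close>
  define \<delta> where "\<delta> = min \<epsilon> (1 / 2)"
  have \<delta>: "\<delta> > 0" "\<delta> \<le> 1 / 2" "\<delta> \<le> \<epsilon>" using assms by (auto simp: \<delta>_def)
  have pow_large: "\<exists>n0. \<forall>n\<ge>n0. a / M ^ n \<le> b" if "b > 0" for a b :: real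
  proof -
    have "(\<lambda>n. a / M ^ n) \<longlonglongrightarrow> 0"
      using M by (intro LIMSEQ_divide_realpow_zero) auto
    then have "eventually (\<lambda>n. a / M ^ n < b) sequentially" using that by (auto dest: order_tendstoD)
    then show ?thesis by (auto simp: eventually_sequentially intro: less_imp_le)
  qed
  \<comment> \<open>A state is a level together with a finite spectrum on whose rescaled elements
    the tail is bounded below.\<close>
  define P where "P s \<longleftrightarrow> spectrum_upto (fst s) (snd s) \<and>
    (\<forall>l\<in>snd s. cmod (tail (fst s) (l / M ^ fst s)) \<ge> \<delta>)" for s
  have "\<exists>f. \<forall>i. P (f i) \<and> (fst (f i) < fst (f (Suc i)) \<and> snd (f i) \<subseteq> snd (f (Suc i)))"
  proof (rule dependent_nat_choice)
    show "\<exists>s. P s"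
      using spectrum_upto_0 \<delta> by (intro exI[of _ "(0, {0})"]) (auto simp: P_def)
  next
    fix s :: "nat \<times> real set" and i :: nat
    assume s: "P s"
    obtain n L where nL: "s = (n, L)" by force
    have "finite L" using s by (simp add: P_def nL spectrum_upto_def)
    obtain n0 where n0: "\<And>n. n \<ge> n0 \<Longrightarrow> C * Max (insert 0 (abs ` L)) / M ^ n \<le> 1 / 2"
      using pow_large[of "1 / 2"] by auto
    obtain n' where n': "n' \<in> S" "n' > max n n0"
      using assms(1) by (meson infinite_nat_iff_unbounded)
    \<comment> \<open>At the level \<open>n'\<close> the old elements are so close to 0 after
      rescaling that the tail differs from 1 by at most 1/2.\<close>
    have small: "cmod (tail n' (l / M ^ n')) \<ge> \<delta>" if "l \<in> L" for l
    proof -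
      have "cmod (tail n' (l / M ^ n') - tail n' 0) \<le> C * \<bar>l\<bar> / M ^ n'"
        using tail_lipschitz[of n' "l / M ^ n'" 0] M by (simp add: abs_mult)
      also have "\<dots> \<le> C * Max (insert 0 (abs ` L)) / M ^ n'"
        using C M \<open>finite L\<close> that by (intro divide_right_mono mult_left_mono Max_ge) auto
      also have "\<dots> \<le> 1 / 2" using n' by (intro n0) auto
      finally show ?thesis
        using norm_triangle_ineq3[of "tail n' (l / M ^ n')" 1] \<delta> by simp
    qed
    obtain L' where L': "L \<subseteq> L'" "spectrum_upto n' L'"
      using spectrum_upto_extend[of n L n'] s n' by (auto simp: P_def nL)
    \<comment> \<open>Old elements get the shift 0, so that the spectra are nested; new ones are
      moved to a point where the tail is large.\<close>
    define h where "h l = (if l \<in> L then 0 else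
      (SOME j. j \<in> \<int> \<and> cmod (tail n' (l / M ^ n' + j)) \<ge> \<epsilon>))" for l
    have h: "h l \<in> \<int> \<and> cmod (tail n' (l / M ^ n' + h l)) \<ge> \<delta>" for l
    proof (cases "l \<in> L")
      case False
      then have "h l \<in> \<int> \<and> cmod (tail n' (l / M ^ n' + h l)) \<ge> \<epsilon>"
        using someI_ex[of "\<lambda>j. j \<in> \<int> \<and> cmod (tail n' (l / M ^ n' + j)) \<ge> \<epsilon>"]
          equipos[OF n'(1), of "l / M ^ n'"] by (auto simp: h_def)
      then show ?thesis using \<delta> by auto
    qed (use small in \<open>auto simp: h_def\<close>)
    let ?L = "(\<lambda>l. l + M ^ n' * h l) ` L'"
    have "P (n', ?L)"
      using spectrum_upto_shift[OF L'(2), of h] h M by (auto simp: P_def add_divide_distrib)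
    moreover have "L \<subseteq> ?L"
    proof
      fix l assume "l \<in> L"
      then show "l \<in> ?L" using L' by (intro image_eqI[of _ _ l]) (auto simp: h_def)
    qed
    ultimately show "\<exists>s'. P s' \<and> (fst s < fst s' \<and> snd s \<subseteq> snd s')"
      using n' by (intro exI[of _ "(n', ?L)"]) (auto simp: nL)
  qed
  then obtain f where f: "\<And>i. P (f i)" "\<And>i. fst (f i) < fst (f (Suc i))"
      "\<And>i. snd (f i) \<subseteq> snd (f (Suc i))" by blast
  define n where "n i = fst (f i)" for i
  define L where "L i = snd (f i)" for i
  have spec: "spectrum_upto (n i) (L i)" and good: "\<And>l. l \<in> L i \<Longrightarrow> cmod (tail (n i) (l / M ^ n i)) \<ge> \<delta>" for i
    using f(1)[of i] by (auto simp: P_def n_def L_def)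
  have fin: "finite (L i)" for i using spec[of i] by (simp add: spectrum_upto_def)
  have sum1: "(\<Sum>l\<in>L i. (cmod (head (n i) (\<xi> + l)))\<^sup>2) = 1" for i \<xi>
    using spec[of i] by (simp add: spectrum_upto_def)
  have n: "strict_mono n" using f(2) by (simp add: n_def strict_mono_Suc_iff)
  have "mono L" using f(3) by (simp add: L_def mono_iff_le_Suc)
  then have L_mono: "L i \<subseteq> L j" if "i \<le> j" for i j using that by (rule monoD)
  show thesis
  proof (rule that[of "\<Union>i. L i"])
    fix l l' assume "l \<in> (\<Union>i. L i)" "l' \<in> (\<Union>i. L i)" "l \<noteq> l'"
    then obtain i j where "l \<in> L i" "l' \<in> L j" by blast
    then have "l \<in> L (max i j)" "l' \<in> L (max i j)"
      using L_mono[of i "max i j"] L_mono[of j "max i j"] by auto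
    then have "head (n (max i j)) (l - l') = 0"
      using spectrum_upto_orthogonal[OF spec] \<open>l \<noteq> l'\<close> by blast
    then show "tail 0 (l - l') = 0" by (subst tail_0_split[of _ "n (max i j)"]) simp
  next
    fix \<xi> \<eta> :: real assume "\<eta> > 0"
    define a where "a i = (\<Sum>l\<in>L i. (cmod (tail 0 (\<xi> + l)))\<^sup>2)" for i
    have split: "(cmod (tail 0 x))\<^sup>2 = (cmod (head i x))\<^sup>2 * (cmod (tail i (x / M ^ i)))\<^sup>2" for x i
      by (subst tail_0_split[of _ i]) (simp add: norm_mult power_mult_distrib)
    have "a i \<le> 1" for i
    proof -
      have "a i \<le> (\<Sum>l\<in>L i. (cmod (head (n i) (\<xi> + l)))\<^sup>2)"
        unfolding a_def
      proof (rule sum_mono)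
        fix l
        have "(cmod (tail (n i) ((\<xi> + l) / M ^ n i)))\<^sup>2 \<le> 1"
          by (intro power_le_one norm_tail_le_1) auto
        then show "(cmod (tail 0 (\<xi> + l)))\<^sup>2 \<le> (cmod (head (n i) (\<xi> + l)))\<^sup>2"
          unfolding split[of _ "n i"] by (intro mult_right_le_one_le) auto
      qed
      then show ?thesis by (simp add: sum1)
    qed
    moreover have "incseq a"
      unfolding a_def incseq_def using L_mono fin by (intro allI impI sum_mono2) auto
    ultimately obtain s where s: "a \<longlonglongrightarrow> s" "\<And>i. a i \<le> s"
      using incseq_convergent[of a 1] by blast
    \<comment> \<open>Chosen so that \<open>4 / \<delta>\<^sup>2 * \<theta>\<close> is half of
      \<eta>.\<close>
    define \<theta> where "\<theta> = \<eta> * \<delta>\<^sup>2 / 8"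
    have \<theta>: "\<theta> > 0" using \<open>\<eta> > 0\<close> \<delta> by (simp add: \<theta>_def)
    then obtain m where m: "a m > s - \<theta>"
      using order_tendstoD(1)[OF s(1), of "s - \<theta>"] by (auto simp: eventually_sequentially)
    obtain n0 where n0: "\<And>n. n \<ge> n0 \<Longrightarrow> C * \<bar>\<xi>\<bar> / M ^ n \<le> \<delta> / 2"
      using pow_large[of "\<delta> / 2"] \<delta> by auto
    \<comment> \<open>Parseval's identity at level \<open>n i\<close> is split at the fixed set
      \<open>L m\<close>. On the other elements the tail stays above \<open>\<delta> / 2\<close>
      even after the shift by \<xi>, so \<open>head\<close> is at most \<open>2 / \<delta>\<close>
      times \<open>tail 0\<close> in norm, and the squares of \<open>tail 0\<close> over these
      elements sum to \<open>a i - a m\<close>, which is below \<theta>.\<close>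
    have ineq: "1 \<le> (\<Sum>l\<in>L m. (cmod (head (n i) (\<xi> + l)))\<^sup>2) + 4 / \<delta>\<^sup>2 * \<theta>" if "i \<ge> max m n0" for i
    proof -
      have "n i \<ge> n0" using that seq_suble[OF n, of i] by simp
      have le: "(cmod (head (n i) (\<xi> + l)))\<^sup>2 \<le> 4 / \<delta>\<^sup>2 * (cmod (tail 0 (\<xi> + l)))\<^sup>2"
        if "l \<in> L i" for l
      proof -
        have "cmod (tail (n i) (l / M ^ n i) - tail (n i) ((\<xi> + l) / M ^ n i)) \<le> C * \<bar>\<xi>\<bar> / M ^ n i"
          using tail_lipschitz[of "n i" "l / M ^ n i" "(\<xi> + l) / M ^ n i"] M
          by (simp add: add_divide_distrib abs_mult)
        also have "\<dots> \<le> \<delta> / 2" using \<open>n i \<ge> n0\<close> by (rule n0)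
        finally have "cmod (tail (n i) ((\<xi> + l) / M ^ n i)) \<ge> \<delta> / 2"
          using good[OF that] norm_triangle_ineq3[of "tail (n i) (l / M ^ n i)"
            "tail (n i) ((\<xi> + l) / M ^ n i)"] by linarith
        then have "(cmod (tail (n i) ((\<xi> + l) / M ^ n i)))\<^sup>2 \<ge> (\<delta> / 2)\<^sup>2"
          using \<delta> by (intro power_mono) auto
        then have "(cmod (head (n i) (\<xi> + l)))\<^sup>2 * (\<delta> / 2)\<^sup>2 \<le> (cmod (tail 0 (\<xi> + l)))\<^sup>2"
          unfolding split[of _ "n i"] by (intro mult_left_mono) auto
        then show ?thesis using \<delta> by (simp add: field_simps power2_eq_square)
      qed
      have "1 = (\<Sum>l\<in>L m. (cmod (head (n i) (\<xi> + l)))\<^sup>2) + (\<Sum>l\<in>L i - L m. (cmod (head (n i) (\<xi> + l)))\<^sup>2)"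
        using sum.subset_diff[OF L_mono[of m i] fin, of "\<lambda>l. (cmod (head (n i) (\<xi> + l)))\<^sup>2"] that
        unfolding sum1 by linarith
      also have "(\<Sum>l\<in>L i - L m. (cmod (head (n i) (\<xi> + l)))\<^sup>2) \<le>
          (\<Sum>l\<in>L i - L m. 4 / \<delta>\<^sup>2 * (cmod (tail 0 (\<xi> + l)))\<^sup>2)"
        by (intro sum_mono le) auto
      also have "\<dots> = 4 / \<delta>\<^sup>2 * (\<Sum>l\<in>L i - L m. (cmod (tail 0 (\<xi> + l)))\<^sup>2)"
        by (rule sum_distrib_left[symmetric])
      also have "(\<Sum>l\<in>L i - L m. (cmod (tail 0 (\<xi> + l)))\<^sup>2) = a i - a m"
        using sum.subset_diff[OF L_mono[of m i] fin, of "\<lambda>l. (cmod (tail 0 (\<xi> + l)))\<^sup>2"] that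
        by (simp add: a_def)
      also have "4 / \<delta>\<^sup>2 * (a i - a m) \<le> 4 / \<delta>\<^sup>2 * \<theta>"
        using m s(2)[of i] by (intro mult_left_mono) auto
      finally show ?thesis by simp
    qed
    \<comment> \<open>While \<open>m\<close> stays fixed, \<open>i\<close> tends to infinity and
      \<open>head\<close> becomes \<open>tail 0\<close> on the finite set
      \<open>L m\<close>.\<close>
    have "(\<lambda>i. (\<Sum>l\<in>L m. (cmod (head (n i) (\<xi> + l)))\<^sup>2) + 4 / \<delta>\<^sup>2 * \<theta>) \<longlonglongrightarrow> a m + 4 / \<delta>\<^sup>2 * \<theta>"
      unfolding a_def
      by (intro tendsto_intros LIMSEQ_subseq_LIMSEQ[OF head_LIMSEQ n, unfolded o_def])
    then have "1 \<le> a m + 4 / \<delta>\<^sup>2 * \<theta>"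
      by (rule LIMSEQ_le_const) (use ineq in blast)
    also have "4 / \<delta>\<^sup>2 * \<theta> = \<eta> / 2" using \<delta> by (simp add: \<theta>_def field_simps)
    finally have "a m > 1 - \<eta>" using \<open>\<eta> > 0\<close> by simp
    then show "\<exists>F. finite F \<and> F \<subseteq> (\<Union>i. L i) \<and> (\<Sum>l\<in>F. (cmod (tail 0 (\<xi> + l)))\<^sup>2) > 1 - \<eta>"
      using fin[of m] by (intro exI[of _ "L m"]) (auto simp: a_def)
  qed
qed

end

section \<open>Equipositivity of the tails\<close>

text \<open>Strong induction on \<open>p\<close>: when \<open>t\<close> divides both \<open>p\<close> and \<open>u\<close>, pass to the multiples of \<open>t * N\<close>
  in the residue class and divide by \<open>t * N\<close>, which replaces \<open>p\<close> by \<open>p div t\<close>.\<close>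

lemma residue_class_avoids:
  fixes t N p u :: int
  assumes "t \<ge> 2" "N > 0" "p > 0" "coprime N p"
  shows "\<exists>j. \<forall>k a. \<not> N dvd a \<longrightarrow> u + p * j \<noteq> a * t * (t * N) ^ k"
  using assms(3,4)
proof (induction "nat p" arbitrary: p u rule: less_induct)
  case less
  show ?case
  proof (cases "t dvd p \<and> t dvd u")
    case False
    \<comment> \<open>Every forbidden value is a multiple of \<open>t\<close>, so a member of the
      class that \<open>t\<close> does not divide suffices.\<close>
    then have "\<exists>j. \<not> t dvd u + p * j"
    proof (cases "t dvd u")
      case True
      then have "\<not> t dvd u + p * 1" using False by (simp add: dvd_add_right_iff)
      then show ?thesis by blast
    next
      case False
      then have "\<not> t dvd u + p * 0" by simp
      then show ?thesis by blast
    qed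
    then obtain j where "\<not> t dvd u + p * j" by blast
    then show ?thesis by (intro exI[of _ j]) auto
  next
    case True
    then obtain q v where q: "p = t * q" and v: "u = t * v" by blast
    have "q > 0" using q less.prems(1) assms(1) by (simp add: zero_less_mult_iff)
    have "q * 2 \<le> p" unfolding q using \<open>q > 0\<close> assms(1) by (simp add: mult.commute)
    then have lt: "nat q < nat p" using \<open>q > 0\<close> by simp
    have "coprime N q" using less.prems(2) q by simp
    \<comment> \<open>By Bezout the class of \<open>v\<close> modulo \<open>q\<close> contains a
      multiple \<open>N * w\<close> of \<open>N\<close>. The \<open>x\<close> obtained last is the
      index of that multiple and no longer the Bezout coefficient.\<close>
    then obtain y x where "y * N + x * q = 1" using bezout_int[of N q] by auto
    then have "v * (y * N + x * q) = v" by simp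
    then have "v + q * (- v * x) = N * (v * y)" by (simp add: algebra_simps)
    then obtain w x where w: "v + q * x = N * w" by blast
    obtain j where j: "\<And>k a. \<not> N dvd a \<Longrightarrow> w + q * j \<noteq> a * t * (t * N) ^ k"
      using less.hyps[OF lt \<open>q > 0\<close> \<open>coprime N q\<close>, of w] by blast
    have eq: "u + p * (x + N * j) = (t * N) * (w + q * j)"
    proof -
      have "u + p * (x + N * j) = t * ((v + q * x) + q * (N * j))"
        by (simp add: q v algebra_simps)
      then show ?thesis by (simp add: w algebra_simps)
    qed
    have "u + p * (x + N * j) \<noteq> a * t * (t * N) ^ k" if a: "\<not> N dvd a" for a k
    proof
      assume *: "u + p * (x + N * j) = a * t * (t * N) ^ k"
      \<comment> \<open>For \<open>k = 0\<close>, cancelling \<open>t\<close> shows that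
        \<open>N\<close> divides \<open>a\<close>. For larger \<open>k\<close> a factor
        \<open>t * N\<close> cancels, and the induction hypothesis for \<open>w\<close> and
        \<open>q\<close> applies.\<close>
      show False
      proof (cases k)
        case 0
        then have "t * (N * (w + q * j)) = t * a" using * eq by (simp add: algebra_simps)
        then have "N * (w + q * j) = a" using assms(1) by simp
        then show False using a by auto
      next
        case (Suc k')
        then have "(t * N) * (w + q * j) = (t * N) * (a * t * (t * N) ^ k')"
          using * eq by (simp add: algebra_simps)
        then have "w + q * j = a * t * (t * N) ^ k'" using assms(1,2) by simp
        then show False using j a by blast
      qed
    qed
    then show ?thesis by blast
  qed
qed

section \<open>Zeros of the factors and uniform lower bounds\<close>

context moran
begin

text \<open>Multiplication by \<open>c m\<close> clears the denominator, so that the zeros can be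
  studied as integers.\<close>

lemma factor_eq_0D:
  assumes "factor m (y / M ^ Suc k) = 0"
  obtains a :: int where "\<not> int N dvd a" "real (c m) * y = real_of_int (a * int t * (int t * int N) ^ k)"
proof -
  define z where "z = real (c m) * (y / M ^ Suc k)"
  have z: "real N * z \<in> \<int>" "z \<notin> \<int>"
    using mask_poly_eq_0D[of N z] assms N by (auto simp: factor_def z_def)
  then obtain a :: int where a: "real N * z = of_int a" by (auto elim: Ints_cases)
  show thesis
  proof (rule that[of a])
    show "\<not> int N dvd a"
    proof
      assume "int N dvd a"
      then obtain b where "a = int N * b" by blast
      then have "z = of_int b" using a N by simp
      then show False using z by simp
    qed
    have "real (c m) * y = z * M ^ Suc k" using M by (simp add: z_def)
    also have "\<dots> = (real N * z) * t * M ^ k" by (simp add: M_def)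
    also have "\<dots> = real_of_int (a * int t * (int t * int N) ^ k)"
      by (simp only: a) (simp add: M_def)
    finally show "real (c m) * y = real_of_int (a * int t * (int t * int N) ^ k)" .
  qed
qed

text \<open>Only finitely many products of \<open>K\<close> factors occur, and for large \<open>K\<close> the remaining factors are
  harmless on bounded sets, so pointwise nonvanishing becomes uniform.\<close>

lemma equipositive_tails:
  assumes "finite J"
    and nz: "\<And>x. x \<in> {0..1} \<Longrightarrow>
      \<exists>j\<in>J. \<forall>n\<in>S. \<forall>k. factor (n + k) ((x + real_of_int j) / M ^ Suc k) \<noteq> 0"
  obtains \<epsilon> where "\<epsilon> > 0" "\<And>n x. n \<in> S \<Longrightarrow> \<exists>j\<in>\<int>. cmod (tail n (x + j)) \<ge> \<epsilon>"
proof -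
  have "J \<noteq> {}" using nz[of 0] by auto
  define B where "B = 1 + Max (abs ` real_of_int ` J)"
  have B: "\<bar>x + real_of_int j\<bar> \<le> B" if "x \<in> {0..1}" "j \<in> J" for x j
  proof -
    have "\<bar>real_of_int j\<bar> \<le> Max (abs ` real_of_int ` J)"
      using that \<open>finite J\<close> by (intro Max_ge) auto
    then show ?thesis using that by (auto simp: B_def)
  qed
  have "(\<lambda>n. C * B / M ^ n) \<longlonglongrightarrow> 0" using M by (intro LIMSEQ_divide_realpow_zero) auto
  then obtain K where K: "C * B / M ^ K < 1 / 2"
    using order_tendstoD(2)[of "\<lambda>n. C * B / M ^ n" 0 sequentially "1 / 2"]
    by (auto simp: eventually_sequentially)
  have rest: "cmod (tail m (y / M ^ K)) \<ge> 1 / 2" if "\<bar>y\<bar> \<le> B" for m y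
  proof -
    have "cmod (tail m (y / M ^ K) - tail m 0) \<le> C * \<bar>y\<bar> / M ^ K"
      using tail_lipschitz[of m "y / M ^ K" 0] M by (simp add: abs_mult)
    also have "\<dots> \<le> C * B / M ^ K"
      using C M that by (intro divide_right_mono mult_left_mono) auto
    finally show ?thesis
      using norm_triangle_ineq3[of "tail m (y / M ^ K)" 1] K unfolding tail_0 norm_one by linarith
  qed
  \<comment> \<open>The words of \<open>K\<close> successive dilations that begin at positions in
    \<open>S\<close>. Restriction identifies positions with the same word, which makes the set
    finite.\<close>
  define W where "W = (\<lambda>n. restrict (\<lambda>k. c (n + k)) {..<K}) ` S"
  define g where "g w y = (\<Prod>k<K. mask_poly N (real (w k) * (y / M ^ Suc k)))" for w :: "nat \<Rightarrow> nat" and y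
  have g: "g (restrict (\<lambda>k. c (n + k)) {..<K}) y = (\<Prod>k<K. factor (n + k) (y / M ^ Suc k))" for n y
    unfolding g_def factor_def by (intro prod.cong) auto
  have "W \<subseteq> {..<K} \<rightarrow>\<^sub>E {..p}" using c_le by (auto simp: W_def PiE_def extensional_def)
  then have "finite W" by (rule finite_subset) (intro finite_PiE, auto)
  have cont: "continuous_on A (\<lambda>x. g w (x + real_of_int j))" for A w j
    unfolding g_def mask_poly_def cis_conv_exp using N M by (auto intro!: continuous_intros)
  \<comment> \<open>The good shift depends on \<open>x\<close>, but the sum over all shifts is
    continuous and positive, so it has a positive minimum on the unit interval.\<close>
  have "\<exists>\<delta>>0. \<forall>x\<in>{0..1}. (\<Sum>j\<in>J. cmod (g w (x + real_of_int j))) \<ge> \<delta>" if "w \<in> W" for w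
  proof -
    have "\<exists>x\<in>{0..1}. \<forall>y\<in>{0..1}. (\<Sum>j\<in>J. cmod (g w (x + real_of_int j))) \<le> (\<Sum>j\<in>J. cmod (g w (y + real_of_int j)))"
      by (intro continuous_attains_inf continuous_on_sum continuous_on_norm cont) auto
    then obtain x :: real where x: "x \<in> {0..1}"
      "\<And>y. y \<in> {0..1} \<Longrightarrow> (\<Sum>j\<in>J. cmod (g w (x + real_of_int j))) \<le> (\<Sum>j\<in>J. cmod (g w (y + real_of_int j)))"
      by blast
    obtain n where n: "n \<in> S" "w = restrict (\<lambda>k. c (n + k)) {..<K}" using \<open>w \<in> W\<close> by (auto simp: W_def)
    obtain j where j: "j \<in> J" "\<forall>n\<in>S. \<forall>k. factor (n + k) ((x + real_of_int j) / M ^ Suc k) \<noteq> 0"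
      using nz x(1) by blast
    have "0 < cmod (g w (x + real_of_int j))"
      using j(2) n by (simp add: g del: power_Suc)
    also have "\<dots> \<le> (\<Sum>j\<in>J. cmod (g w (x + real_of_int j)))"
      using j(1) \<open>finite J\<close> by (intro member_le_sum) auto
    finally show ?thesis using x(2) by blast
  qed
  then obtain \<delta> where \<delta>: "\<And>w. w \<in> W \<Longrightarrow> \<delta> w > 0"
      "\<And>w x. w \<in> W \<Longrightarrow> x \<in> {0..1} \<Longrightarrow> (\<Sum>j\<in>J. cmod (g w (x + real_of_int j))) \<ge> \<delta> w"
    by metis
  \<comment> \<open>Some summand is at least the average, hence at least
    \<open>2 * \<epsilon>\<close>, and the tail behind the first \<open>K\<close> factors costs at
    most one half. The inserted 1 keeps the minimum meaningful when \<open>S\<close> is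
    empty.\<close>
  define \<epsilon> where "\<epsilon> = Min (insert 1 (\<delta> ` W)) / card J / 2"
  show thesis
  proof (rule that[of \<epsilon>])
    show "\<epsilon> > 0"
      using \<delta>(1) \<open>finite W\<close> \<open>finite J\<close> \<open>J \<noteq> {}\<close> by (simp add: \<epsilon>_def card_gt_0_iff)
    fix n and x :: real assume "n \<in> S"
    define w where "w = restrict (\<lambda>k. c (n + k)) {..<K}"
    have "w \<in> W" using \<open>n \<in> S\<close> by (auto simp: w_def W_def)
    \<comment> \<open>Only the coset of \<open>x\<close> modulo the integers matters; the floor of
      \<open>x\<close> is absorbed into the shift at the end.\<close>
    have x: "frac x \<in> {0..1}" using frac_lt_1[of x] by simp
    have "\<exists>j\<in>J. cmod (g w (frac x + real_of_int j)) \<ge> 2 * \<epsilon>"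
    proof (rule ccontr)
      assume "\<not> (\<exists>j\<in>J. cmod (g w (frac x + real_of_int j)) \<ge> 2 * \<epsilon>)"
      then have "(\<Sum>j\<in>J. cmod (g w (frac x + real_of_int j))) < (\<Sum>j\<in>J. 2 * \<epsilon>)"
        using \<open>finite J\<close> \<open>J \<noteq> {}\<close> by (intro sum_strict_mono) auto
      also have "\<dots> = Min (insert 1 (\<delta> ` W))" using \<open>finite J\<close> \<open>J \<noteq> {}\<close> by (simp add: \<epsilon>_def)
      also have "\<dots> \<le> \<delta> w" using \<open>finite W\<close> \<open>w \<in> W\<close> by (intro Min_le) auto
      finally show False using \<delta>(2)[OF \<open>w \<in> W\<close> x] by simp
    qed
    then obtain j where j: "j \<in> J" "cmod (g w (frac x + real_of_int j)) \<ge> 2 * \<epsilon>" by blast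
    let ?y = "frac x + real_of_int j"
    have "cmod (tail n ?y) = cmod (g w ?y) * cmod (tail (n + K) (?y / M ^ K))"
      unfolding tail_split[of n ?y K] g w_def norm_mult ..
    also have "\<dots> \<ge> 2 * \<epsilon> * (1 / 2)"
      using j rest B x \<open>\<epsilon> > 0\<close> by (intro mult_mono) auto
    finally have "cmod (tail n (x + of_int (j - \<lfloor>x\<rfloor>))) \<ge> \<epsilon>" by (simp add: frac_def algebra_simps)
    then show "\<exists>j\<in>\<int>. cmod (tail n (x + j)) \<ge> \<epsilon>" by (blast intro: Ints_of_int)
  qed
qed

text \<open>An endpoint can be moved to 0, where every factor is 1. At the other points, and their
  integer translates, factors with dilation 1 do not vanish.\<close>

lemma (in -) unit_interval_cases:
  assumes "x \<in> {0..1 :: real}"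
  obtains "x \<in> {0, 1}" | "x \<notin> \<int>"
proof (cases "x \<in> \<int>")
  case True
  then obtain k :: int where "x = of_int k" by (auto elim: Ints_cases)
  then have "k \<in> {0..1}" using assms by auto
  then have "k = 0 \<or> k = 1" by auto
  then show ?thesis using that(1) \<open>x = of_int k\<close> by auto
qed (use that in blast)

text \<open>At a non-integral \<open>x\<close> only factors with dilation \<open>p\<close> can
  vanish, and only if \<open>p * x\<close> is an integer \<open>u\<close>. Then
  \<open>residue_class_avoids\<close> gives a shift depending on \<open>u\<close> alone, and
  \<open>u\<close> lies in \<open>{0..int p}\<close>, so finitely many shifts suffice for all
  tails.\<close>

lemma spectrum_exists_if_t_ge_2:
  assumes "t \<ge> 2" "p \<ge> 1" "Rings.coprime p N" and c: "\<And>k. c k \<in> {1, p}"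
  obtains \<Lambda> where "\<And>l l'. l \<in> \<Lambda> \<Longrightarrow> l' \<in> \<Lambda> \<Longrightarrow> l \<noteq> l' \<Longrightarrow> tail 0 (l - l') = 0"
    "\<And>\<xi> \<eta>. \<eta> > 0 \<Longrightarrow> \<exists>F. finite F \<and> F \<subseteq> \<Lambda> \<and> (\<Sum>l\<in>F. (cmod (tail 0 (\<xi> + l)))\<^sup>2) > 1 - \<eta>"
proof -
  have "\<exists>j. \<forall>k a. \<not> int N dvd a \<longrightarrow> u + int p * j \<noteq> a * int t * (int t * int N) ^ k" for u
    using assms N by (intro residue_class_avoids) (auto simp: coprime_commute)
  then obtain J where J: "\<And>u a k. \<not> int N dvd a \<Longrightarrow> u + int p * J u \<noteq> a * int t * (int t * int N) ^ k"
    by metis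
  obtain \<epsilon> where "\<epsilon> > 0" "\<And>n x. n \<in> UNIV \<Longrightarrow> \<exists>j\<in>\<int>. cmod (tail n (x + j)) \<ge> \<epsilon>"
  proof (rule equipositive_tails[where S=UNIV and J="{0, -1} \<union> J ` {0..int p}"])
    fix x :: real assume "x \<in> {0..1}"
    then show "\<exists>j\<in>{0, -1} \<union> J ` {0..int p}. \<forall>n\<in>UNIV. \<forall>k.
        factor (n + k) ((x + real_of_int j) / M ^ Suc k) \<noteq> 0"
    proof (cases rule: unit_interval_cases)
      case 1
      then show ?thesis by (auto simp del: power_Suc intro!: bexI[of _ "if x = 0 then 0 else - 1"])
    next
      case 2
      show ?thesis
      proof (cases "real p * x \<in> \<int>")
        case True
        then obtain u :: int where u: "real p * x = of_int u" by (auto elim: Ints_cases)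
        have "0 \<le> real p * x" "real p * x \<le> real p * 1"
          using \<open>x \<in> {0..1}\<close> by (auto intro!: mult_left_le)
        then have "u \<in> {0..int p}" unfolding u by auto
        moreover have "factor (n + k) ((x + real_of_int (J u)) / M ^ Suc k) \<noteq> 0" for n k
        proof
          assume "factor (n + k) ((x + real_of_int (J u)) / M ^ Suc k) = 0"
          then obtain a where a: "\<not> int N dvd a"
              "real (c (n + k)) * (x + real_of_int (J u)) = real_of_int (a * int t * (int t * int N) ^ k)"
            by (rule factor_eq_0D)
          show False
          proof (cases "c (n + k) = 1")
            case True
            then have "x = real_of_int (a * int t * (int t * int N) ^ k - J u)" using a by simp
            then show False using 2 by (metis Ints_of_int)
          next
            case False
            then have "real_of_int (u + int p * J u) = real_of_int (a * int t * (int t * int N) ^ k)"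
              using a c[of "n + k"] u by (simp add: distrib_left)
            then show False using J[OF a(1)] unfolding of_int_eq_iff by blast
          qed
        qed
        ultimately show ?thesis by blast
      next
        case False
        have "factor (n + k) ((x + real_of_int 0) / M ^ Suc k) \<noteq> 0" for n k
        proof
          assume "factor (n + k) ((x + real_of_int 0) / M ^ Suc k) = 0"
          then obtain a where "real (c (n + k)) * (x + real_of_int 0) = real_of_int a"
            by (rule factor_eq_0D) blast
          then have "real (c (n + k)) * x \<in> \<int>" by simp
          then show False using False 2 c[of "n + k"] by auto
        qed
        then show ?thesis by blast
      qed
    qed
  qed auto
  then show thesis
    using spectrum_from_equipositive_tails[of UNIV \<epsilon>] that by blast
qed

text \<open>Take tails that start with dilation 1. At a non-integral point a vanishing factor has
  dilation \<open>p\<close>, hence is not the first one, and this forces \<open>p * (x + j)\<close>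
  to be a multiple of \<open>N\<close>. That cannot happen for both \<open>j = 0\<close> and
  \<open>j = 1\<close>, since \<open>N\<close> does not divide \<open>p\<close>.\<close>

lemma spectrum_exists_if_t_eq_1:
  assumes "t = 1" "Rings.coprime p N" and c: "\<And>k. c k \<in> {1, p}" "infinite {k. c k = 1}"
  obtains \<Lambda> where "\<And>l l'. l \<in> \<Lambda> \<Longrightarrow> l' \<in> \<Lambda> \<Longrightarrow> l \<noteq> l' \<Longrightarrow> tail 0 (l - l') = 0"
    "\<And>\<xi> \<eta>. \<eta> > 0 \<Longrightarrow> \<exists>F. finite F \<and> F \<subseteq> \<Lambda> \<and> (\<Sum>l\<in>F. (cmod (tail 0 (\<xi> + l)))\<^sup>2) > 1 - \<eta>"
proof -
  obtain \<epsilon> where "\<epsilon> > 0" "\<And>n x. n \<in> {k. c k = 1} \<Longrightarrow> \<exists>j\<in>\<int>. cmod (tail n (x + j)) \<ge> \<epsilon>"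
  proof (rule equipositive_tails[where S="{k. c k = 1}" and J="{0, -1, 1}"])
    fix x :: real assume "x \<in> {0..1}"
    then show "\<exists>j\<in>{0, -1, 1}. \<forall>n\<in>{k. c k = 1}. \<forall>k.
        factor (n + k) ((x + real_of_int j) / M ^ Suc k) \<noteq> 0"
    proof (cases rule: unit_interval_cases)
      case 1
      then show ?thesis by (auto simp del: power_Suc intro!: bexI[of _ "if x = 0 then 0 else - 1"])
    next
      case 2
      have zero: "\<exists>b::int. real p * (x + real_of_int j) = of_int (int N * b)"
        if "c n = 1" "factor (n + k) ((x + real_of_int j) / M ^ Suc k) = 0" for n k j
      proof -
        from that(2) obtain a where a: "\<not> int N dvd a"
            "real (c (n + k)) * (x + real_of_int j) = real_of_int (a * int t * (int t * int N) ^ k)"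
          by (rule factor_eq_0D)
        have "c (n + k) \<noteq> 1"
        proof
          assume "c (n + k) = 1"
          then have "x = real_of_int (a * int t * (int t * int N) ^ k - j)" using a by simp
          then show False using 2 by (metis Ints_of_int)
        qed
        then have "c (n + k) = p" "k \<noteq> 0" using that(1) c(1)[of "n + k"] by (auto intro: ccontr)
        then obtain k' where "k = Suc k'" "c (n + k) = p" by (cases k) auto
        then have "real p * (x + real_of_int j) = of_int (int N * (a * int N ^ k'))"
          using a(2) assms(1) by simp
        then show ?thesis by blast
      qed
      show ?thesis
      proof (cases "\<exists>b::int. real p * (x + real_of_int 0) = of_int (int N * b)")
        case True
        then obtain b :: int where b: "real p * x = of_int (int N * b)" by auto
        have "\<not> (\<exists>b::int. real p * (x + real_of_int 1) = of_int (int N * b))"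
        proof
          assume "\<exists>b::int. real p * (x + real_of_int 1) = of_int (int N * b)"
          then obtain b' :: int where "real p * x + real p = of_int (int N * b')"
            by (auto simp: distrib_left)
          then have "real_of_int (int p) = of_int (int N * (b' - b))"
            using b by (simp add: algebra_simps)
          then have "int p = int N * (b' - b)" by (simp only: of_int_eq_iff)
          then have "int N dvd int p" by simp
          then have "N dvd p" by simp
          then have "N = 1" using assms(2) by (metis coprime_absorb_right is_unit_gcd coprime_common_divisor dvd_refl nat_dvd_1_iff_1)
          then show False using N by simp
        qed
        then show ?thesis using zero by blast
      next
        case False
        then show ?thesis using zero by blast
      qed
    qed
  qed auto
  then show thesis
    using spectrum_from_equipositive_tails[of "{k. c k = 1}" \<epsilon>] c(2) that by blast
qed

end

section \<open>Infinite convolutions\<close>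

lemma real_distribution_uniform_dirac: "real_distribution (uniform_dirac A)"
  unfolding uniform_dirac_def
  by (simp add: real_distribution_def real_distribution_axioms_def measure_pmf.prob_space_distr)

lemma real_distribution_convolution:
  assumes "real_distribution A" "real_distribution B"
  shows "real_distribution (convolution A B)"
proof -
  interpret A: real_distribution A by fact
  interpret B: real_distribution B by fact
  interpret pair_prob_space A B ..
  show ?thesis unfolding convolution_def by (intro real_distribution_distr) simp
qed

lemma char_uniform_dirac:
  assumes "finite A" "A \<noteq> {}"
  shows "char (uniform_dirac A) s = (\<Sum>a\<in>A. cis (s * a)) / card A"
proof -
  have "char (uniform_dirac A) s = measure_pmf.expectation (pmf_of_set A) (\<lambda>x. iexp (s * x))"
    unfolding char_def uniform_dirac_def by (subst integral_distr) auto
  also have "\<dots> = (\<Sum>a\<in>A. pmf (pmf_of_set A) a *\<^sub>R iexp (s * a))"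
    using assms by (intro integral_measure_pmf) auto
  finally show ?thesis
    using assms by (simp add: cis_conv_exp sum_divide_distrib scaleR_conv_of_real field_simps)
qed

lemma char_convolution:
  assumes "real_distribution A" "real_distribution B"
  shows "char (convolution A B) s = char A s * char B s"
proof -
  interpret A: real_distribution A by fact
  interpret B: real_distribution B by fact
  interpret pair_prob_space A B ..
  have "char (convolution A B) s = (\<integral>z. iexp (s * (fst z + snd z)) \<partial>(A \<Otimes>\<^sub>M B))"
    unfolding char_def convolution_def by (subst integral_distr) (auto simp: case_prod_unfold)
  also have "\<dots> = (\<integral>x. \<integral>y. iexp (s * (x + y)) \<partial>B \<partial>A)"
    by (subst integral_fst'[symmetric]) (auto intro!: integrable_const_bound[where B=1])
  also have "\<dots> = (\<integral>x. iexp (s * x) * char B s \<partial>A)"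
    by (simp add: distrib_left exp_add char_def)
  also have "\<dots> = char A s * char B s" by (simp add: char_def)
  finally show ?thesis .
qed

lemma AE_uniform_dirac:
  assumes "finite A" "A \<noteq> {}" "\<And>a. a \<in> A \<Longrightarrow> a \<in> Z" "Z \<in> sets borel"
  shows "AE x in uniform_dirac A. x \<in> Z"
  unfolding uniform_dirac_def using assms by (subst AE_distr_iff) (auto simp: AE_measure_pmf_iff)

lemma AE_convolution:
  assumes "real_distribution A" "real_distribution B" "AE x in A. x \<in> X" "AE y in B. y \<in> Y"
    and [measurable]: "Z \<in> sets borel" and Z: "\<And>x y. x \<in> X \<Longrightarrow> y \<in> Y \<Longrightarrow> x + y \<in> Z"
  shows "AE z in convolution A B. z \<in> Z"
proof -
  interpret A: real_distribution A by fact
  interpret B: real_distribution B by fact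
  interpret pair_prob_space A B ..
  have [measurable_cong]: "sets A = sets borel" "sets B = sets borel" by simp_all
  have "AE x in A. AE y in B. x + y \<in> Z"
    using assms(3) by eventually_elim (use assms(4) in eventually_elim, rule Z)
  then have "AE z in A \<Otimes>\<^sub>M B. fst z + snd z \<in> Z"
  proof (intro AE_pair_measure)
    show "{z \<in> space (A \<Otimes>\<^sub>M B). fst z + snd z \<in> Z} \<in> sets (A \<Otimes>\<^sub>M B)" by measurable
  qed auto
  then show ?thesis
    unfolding convolution_def by (subst AE_distr_iff) (auto simp: case_prod_unfold)
qed

section \<open>The infinite convolution and its Fourier transform\<close>

context moran
begin

definition piece :: "nat \<Rightarrow> real measure" where
  "piece k = uniform_dirac ((\<lambda>b. inverse (M ^ Suc k) * b) ` (\<lambda>b. real (c k) * b) ` real ` {0..<N})"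

definition mu :: "real measure" where
  "mu = infinite_convolution piece"

lemma piece_altdef: "piece k = uniform_dirac ((\<lambda>j. real (c k) * real j / M ^ Suc k) ` {..<N})"
  unfolding piece_def image_image lessThan_atLeast0 by (simp add: field_simps)

lemma c_pos: "c k > 0"
  using coprime[of k] N by (cases "c k = 0") auto

lemma char_piece: "char (piece k) (2 * pi * \<xi>) = factor k (\<xi> / M ^ Suc k)"
proof -
  have inj: "inj_on (\<lambda>j. real (c k) * real j / M ^ Suc k) {..<N}"
    using M c_pos[of k] by (intro inj_onI) simp
  have "char (piece k) (2 * pi * \<xi>) = (\<Sum>j<N. cis (2 * pi * \<xi> * (real (c k) * real j / M ^ Suc k))) / N"
    using N unfolding piece_altdef
    by (subst char_uniform_dirac)
       (auto simp: sum.reindex[OF inj] card_image[OF inj] lessThan_empty_iff simp del: power_Suc)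
  then show ?thesis by (simp add: factor_def mask_poly_def mult_ac)
qed

lemma real_distribution_piece: "real_distribution (piece k)"
  unfolding piece_def by (rule real_distribution_uniform_dirac)

lemma real_distribution_partial: "real_distribution (partial_convolution piece n)"
  by (induction n) (auto intro: real_distribution_piece real_distribution_convolution)

text \<open>The partial convolution with index \<open>n\<close> has \<open>n + 1\<close> factors,
  hence \<open>Suc n\<close>.\<close>

lemma char_partial: "char (partial_convolution piece n) (2 * pi * \<xi>) = head (Suc n) \<xi>"
proof (induction n)
  case (Suc n)
  then show ?case
    by (simp add: char_convolution real_distribution_partial real_distribution_piece char_piece head_Suc
        del: power_Suc)
qed (simp add: char_piece head_def)

lemma AE_piece: "Z \<in> sets borel \<Longrightarrow> (\<And>j. j < N \<Longrightarrow> real (c k) * real j / M ^ Suc k \<in> Z) \<Longrightarrow>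
    AE x in piece k. x \<in> Z"
  using N unfolding piece_altdef by (intro AE_uniform_dirac) (auto simp: lessThan_empty_iff)

lemma AE_partial_bounded: "AE x in partial_convolution piece n. x \<in> {0..real (p * N)}"
proof -
  have piece: "AE x in piece k. x \<in> {0..real (p * N) * (1 / M ^ Suc k)}" for k
  proof (rule AE_piece)
    fix j assume "j < N"
    then have "real (c k * j) \<le> real (p * N)" using c_le[of k] by (intro of_nat_mono mult_mono) auto
    then show "real (c k) * real j / M ^ Suc k \<in> {0..real (p * N) * (1 / M ^ Suc k)}"
      using M by (auto intro!: divide_right_mono)
  qed simp
  have "AE x in partial_convolution piece n. x \<in> {0..real (p * N) * (\<Sum>k<Suc n. 1 / M ^ Suc k)}"
  proof (induction n)
    case 0
    then show ?case using piece[of 0] by (simp only: partial_convolution.simps) simp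
  next
    case (Suc n)
    show ?case unfolding partial_convolution.simps
      by (rule AE_convolution[OF real_distribution_partial real_distribution_piece Suc piece])
         (auto simp: distrib_left)
  qed
  then show ?thesis
  proof eventually_elim
    case (elim x)
    have "real (p * N) * (\<Sum>k<Suc n. 1 / M ^ Suc k) \<le> real (p * N) * 1"
      by (intro mult_left_mono sum_inverse_powers_le) auto
    then show ?case using elim by auto
  qed
qed

lemma tight_partial: "tight (partial_convolution piece)"
  unfolding tight_def
proof (intro conjI allI impI real_distribution_partial)
  fix \<epsilon> :: real assume "\<epsilon> > 0"
  have "measure (partial_convolution piece n) {-1<..real (p * N)} = 1" for n
  proof -
    interpret real_distribution "partial_convolution piece n" by (rule real_distribution_partial)
    show ?thesis
      using AE_partial_bounded[of n] by (intro prob_eq_1[THEN iffD2]) auto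
  qed
  then show "\<exists>a b. a < b \<and> (\<forall>n. 1 - \<epsilon> < measure (partial_convolution piece n) {a<..b})"
    using \<open>\<epsilon> > 0\<close> by (intro exI[of _ "-1"] exI[of _ "real (p * N)"]) 
      (simp add: less_le_trans[of _ 0])
qed

text \<open>Tightness provides a weakly convergent subsequence. The characteristic functions of the
  whole sequence converge to \<open>tail 0\<close>, so this is the characteristic function of the
  subsequential limit, and Levy continuity makes the whole sequence converge to it. Uniqueness of
  weak limits identifies it with \<open>mu\<close>.\<close>

lemma mu_weak_limit: "weak_limit (partial_convolution piece) mu"
  and char_mu: "char mu (2 * pi * \<xi>) = tail 0 \<xi>"
proof -
  obtain r \<nu> where r: "strict_mono r" "real_distribution \<nu>"
      "weak_conv_m (partial_convolution piece \<circ> id \<circ> r) \<nu>"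
    using tight_imp_convergent_subsubsequence[OF tight_partial strict_mono_id] by blast
  have lim: "(\<lambda>n. char (partial_convolution piece n) s) \<longlonglongrightarrow> tail 0 (s / (2 * pi))" for s
    using LIMSEQ_Suc[OF head_LIMSEQ[of "s / (2 * pi)"]]
    by (simp flip: char_partial)
  have char: "char \<nu> s = tail 0 (s / (2 * pi))" for s
  proof (rule LIMSEQ_unique)
    show "(\<lambda>n. char ((partial_convolution piece \<circ> id \<circ> r) n) s) \<longlonglongrightarrow> char \<nu> s"
      using r real_distribution_partial
      by (intro levy_continuity1[of "partial_convolution piece \<circ> id \<circ> r"]) (simp_all only: o_apply)
    show "(\<lambda>n. char ((partial_convolution piece \<circ> id \<circ> r) n) s) \<longlonglongrightarrow> tail 0 (s / (2 * pi))"
      using LIMSEQ_subseq_LIMSEQ[OF lim r(1)] by (simp add: o_def)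
  qed
  then have "weak_conv_m (partial_convolution piece) \<nu>"
    using lim by (intro levy_continuity real_distribution_partial r) simp
  then have \<nu>: "weak_limit (partial_convolution piece) \<nu>"
    using weak_limit_iff_weak_conv_m real_distribution_partial r(2) by blast
  then have "mu = \<nu>"
    unfolding mu_def infinite_convolution_def by (blast intro: weak_limit_unique)
  then show "weak_limit (partial_convolution piece) mu" "char mu (2 * pi * \<xi>) = tail 0 \<xi>"
    using \<nu> char by auto
qed

lemma real_distribution_mu: "real_distribution mu"
  using mu_weak_limit by (simp add: weak_limit_def)

lemma AE_mu_bounded: "AE x in mu. \<bar>x\<bar> \<le> real (p * N)"
proof -
  interpret real_distribution mu by (rule real_distribution_mu)
  \<comment> \<open>A bounded continuous function that vanishes exactly on the common bounded set,
    so that the support bound passes to the weak limit.\<close>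
  define f :: "real \<Rightarrow> real" where "f x = min 1 (max 0 (\<bar>x\<bar> - real (p * N)))" for x
  have f: "continuous_on UNIV f" unfolding f_def by (intro continuous_intros)
  have "bounded (range f)"
    unfolding bounded_iff by (intro exI[of _ 1]) (auto simp: f_def)
  then have "(\<lambda>n. integral\<^sup>L (partial_convolution piece n) f) \<longlonglongrightarrow> integral\<^sup>L mu f"
    using mu_weak_limit f unfolding weak_limit_def by blast
  moreover have "integral\<^sup>L (partial_convolution piece n) f = 0" for n
    using AE_partial_bounded[of n] by (intro integral_eq_zero_AE) (auto simp: f_def)
  ultimately have "integral\<^sup>L mu f = 0" by (simp add: LIMSEQ_const_iff)
  moreover have [measurable]: "f \<in> borel_measurable borel" using f by (rule borel_measurable_continuous_onI)
  have "integrable mu f" by (intro integrable_const_bound[where B=1]) (auto simp: f_def)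
  ultimately have "AE x in mu. f x = 0"
    by (subst (asm) integral_nonneg_eq_0_iff_AE) (auto simp: f_def)
  then show ?thesis by eventually_elim (auto simp: f_def min_def max_def split: if_splits)
qed

text \<open>The factor \<open>q\<close> admits dilates of the measure. The sign in
  \<open>- l / q\<close> turns the sums \<open>\<xi> + l\<close> of the construction into the
  differences of \<open>spectral_measureI\<close>.\<close>

lemma spectral_measure_if_tail:
  assumes \<nu>: "real_distribution \<nu>" "AE x in \<nu>. \<bar>x\<bar> \<le> R" "q > 0" "\<And>\<xi>. char \<nu> (2 * pi * \<xi>) = tail 0 (q * \<xi>)"
    and orth: "\<And>l l'. l \<in> \<Lambda> \<Longrightarrow> l' \<in> \<Lambda> \<Longrightarrow> l \<noteq> l' \<Longrightarrow> tail 0 (l - l') = 0"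
    and complete: "\<And>\<xi> \<eta>. \<eta> > 0 \<Longrightarrow> \<exists>F. finite F \<and> F \<subseteq> \<Lambda> \<and> (\<Sum>l\<in>F. (cmod (tail 0 (\<xi> + l)))\<^sup>2) > 1 - \<eta>"
  shows "spectral_measure \<nu>"
proof (rule spectral_measureI[OF \<nu>(1,2), of "(\<lambda>l. - l / q) ` \<Lambda>"])
  fix l l' assume "l \<in> (\<lambda>l. - l / q) ` \<Lambda>" "l' \<in> (\<lambda>l. - l / q) ` \<Lambda>" "l \<noteq> l'"
  then obtain k k' where k: "k \<in> \<Lambda>" "k' \<in> \<Lambda>" "l = - k / q" "l' = - k' / q" "k \<noteq> k'" by blast
  then have "q * (l - l') = k' - k" using \<nu>(3) by (simp add: field_simps)
  then show "char \<nu> (2 * pi * (l - l')) = 0" using orth k by (simp add: \<nu>(4))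
next
  fix \<xi> \<eta> :: real assume "\<eta> > 0"
  then obtain F where F: "finite F" "F \<subseteq> \<Lambda>" "(\<Sum>l\<in>F. (cmod (tail 0 (q * \<xi> + l)))\<^sup>2) > 1 - \<eta>"
    using complete by blast
  have "inj_on (\<lambda>l. - l / q) F" using \<nu>(3) by (auto simp: inj_on_def)
  moreover have "q * (\<xi> - - l / q) = q * \<xi> + l" for l using \<nu>(3) by (simp add: field_simps)
  ultimately have "(\<Sum>l\<in>(\<lambda>l. - l / q) ` F. (cmod (char \<nu> (2 * pi * (\<xi> - l))))\<^sup>2) > 1 - \<eta>"
    using F(3) by (simp only: sum.reindex \<nu>(4) o_def)
  then show "\<exists>F. finite F \<and> F \<subseteq> (\<lambda>l. - l / q) ` \<Lambda> \<and>
      (\<Sum>l\<in>F. (cmod (char \<nu> (2 * pi * (\<xi> - l))))\<^sup>2) > 1 - \<eta>"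
    using F by (intro exI[of _ "(\<lambda>l. - l / q) ` F"]) auto
qed

end

section \<open>A scaled translate obstructs spectrality\<close>

text \<open>A finite part \<open>F\<close> of the basis suffices. With \<open>a\<close> the squared
  norm of the first indicator and \<open>s\<close> the sum of its squared coefficients over
  \<open>F\<close>, good approximation gives \<open>s > a / r\<close>, while Bessel's inequality for
  the second indicator gives \<open>s \<le> a / r\<close>.\<close>

lemma not_spectral_if_translate_scaled:
  assumes M: "real_distribution M" and r: "r > 1"
    and pos: "measure M {0..<h} > 0"
    and scaled: "\<And>A. A \<in> sets borel \<Longrightarrow> A \<subseteq> {0..<h} \<Longrightarrow>
      emeasure M ((\<lambda>x. x - h) -` A) = ennreal r * emeasure M A"
  shows "\<not> spectral_measure M"
proof
  assume "spectral_measure M"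
  interpret real_distribution M by fact
  define e :: "real \<Rightarrow> real \<Rightarrow> complex"
    where "e = (\<lambda>l x. exp (2 * of_real pi * \<i> * of_real l * of_real x))"
  obtain \<Lambda> where \<Lambda>: "L2_orthonormal_basis M \<Lambda> e"
    using \<open>spectral_measure M\<close> unfolding spectral_measure_def e_def by blast
  let ?f = "\<lambda>x. indicator {0..<h} x :: complex"
  let ?g = "\<lambda>x. indicator {h..<2 * h} x :: complex"
  have f: "?f \<in> L2_space M" and g: "?g \<in> L2_space M"
    by (auto intro!: L2_spaceI_bounded[where B=1] simp: indicator_def)
  \<comment> \<open>The scaling hypothesis on sets becomes one on integrals by comparing the part of
    the measure on the second interval, moved back by \<open>h\<close>, with \<open>r\<close> times
    the part on the first.\<close>
  have transfer: "(\<integral>x. indicator {h..<2 * h} x * u x \<partial>M) = of_real r * (\<integral>x. indicator {0..<h} x * u (x + h) \<partial>M)"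
    if [measurable]: "u \<in> borel_measurable borel" for u :: "real \<Rightarrow> complex"
  proof -
    have "distr (density M (indicator {h..<2 * h})) borel (\<lambda>x. x - h) =
        density M (\<lambda>x. ennreal (r * indicator {0..<h} x))" (is "?A = ?B")
    proof (rule measure_eqI)
      fix A assume "A \<in> sets ?A"
      then have [measurable]: "A \<in> sets borel" by simp
      have [measurable]: "(\<lambda>x. x - h) -` B \<in> sets borel" if "B \<in> sets borel" for B
        using measurable_sets[of "\<lambda>x. x - h" borel borel B] that by simp
      have "emeasure ?A A = emeasure (density M (indicator {h..<2 * h})) ((\<lambda>x. x - h) -` A)"
        by (simp add: emeasure_distr)
      also have "\<dots> = (\<integral>\<^sup>+x. indicator {h..<2 * h} x * indicator ((\<lambda>x. x - h) -` A) x \<partial>M)"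
        by (rule emeasure_density) auto
      also have "\<dots> = (\<integral>\<^sup>+x. indicator ((\<lambda>x. x - h) -` (A \<inter> {0..<h})) x \<partial>M)"
        by (intro nn_integral_cong) (auto simp: indicator_def)
      also have "\<dots> = emeasure M ((\<lambda>x. x - h) -` (A \<inter> {0..<h}))"
        by (rule nn_integral_indicator) simp
      also have "\<dots> = ennreal r * emeasure M (A \<inter> {0..<h})" by (rule scaled) auto
      also have "\<dots> = (\<integral>\<^sup>+x. ennreal r * indicator (A \<inter> {0..<h}) x \<partial>M)"
        by (simp add: nn_integral_cmult_indicator)
      also have "\<dots> = emeasure ?B A"
        by (auto simp: emeasure_density indicator_def intro!: nn_integral_cong)
      finally show "emeasure ?A A = emeasure ?B A" .
    qed simp
    then have "(\<integral>x. u (x + h) \<partial>?A) = (\<integral>x. u (x + h) \<partial>?B)" by simp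
    moreover have "(\<integral>x. u (x + h) \<partial>?A) = (\<integral>x. indicator {h..<2 * h} x * u x \<partial>M)"
    proof -
      have "(\<integral>x. u (x + h) \<partial>?A) = (\<integral>x. u x \<partial>density M (\<lambda>x. ennreal (indicator {h..<2 * h} x)))"
        by (subst integral_distr) (auto simp: ennreal_indicator)
      also have "\<dots> = (\<integral>x. indicator {h..<2 * h} x *\<^sub>R u x \<partial>M)"
        by (rule integral_density) auto
      finally show ?thesis by (simp add: indicator_scaleR_eq_if if_distrib indicator_times_eq_if)
    qed
    moreover have "(\<integral>x. u (x + h) \<partial>?B) = of_real r * (\<integral>x. indicator {0..<h} x * u (x + h) \<partial>M)"
    proof -
      have "(\<integral>x. u (x + h) \<partial>?B) = (\<integral>x. (r * indicator {0..<h} x) *\<^sub>R u (x + h) \<partial>M)"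
        using r by (intro integral_density) auto
      also have "\<dots> = (\<integral>x. of_real r * (indicator {0..<h} x * u (x + h)) \<partial>M)"
        by (intro Bochner_Integration.integral_cong) (auto simp: indicator_def scaleR_conv_of_real)
      finally show ?thesis by simp
    qed
    ultimately show ?thesis by simp
  qed
  have e: "e l \<in> borel_measurable borel" for l
    unfolding e_def by measurable
  \<comment> \<open>Translation multiplies an exponential by a constant of modulus 1, so only
    \<open>r\<close> remains.\<close>
  have inner: "cmod (L2_inner M ?g (e l)) = r * cmod (L2_inner M ?f (e l))" for l
  proof -
    have [measurable]: "(\<lambda>x. cnj (e l x)) \<in> borel_measurable borel"
      unfolding e_def exp_eq_cis cis_cnj unfolding cis_conv_exp by measurable
    have "L2_inner M ?g (e l) = of_real r * (\<integral>x. indicator {0..<h} x * cnj (e l (x + h)) \<partial>M)"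
      unfolding L2_inner_def by (rule transfer) measurable
    also have "cnj (e l (x + h)) = cnj (e l h) * cnj (e l x)" for x
      unfolding e_def exp_eq_cis cis_cnj cis_mult by (simp add: algebra_simps)
    then have "(\<integral>x. indicator {0..<h} x * cnj (e l (x + h)) \<partial>M) = cnj (e l h) * L2_inner M ?f (e l)"
      unfolding L2_inner_def by (simp add: mult.left_commute)
    finally show ?thesis
      using r by (simp add: norm_mult) (simp add: e_def exp_eq_cis)
  qed
  have sq: "(\<integral>x. (cmod (?g x))\<^sup>2 \<partial>M) = r * (\<integral>x. (cmod (?f x))\<^sup>2 \<partial>M)"
  proof -
    have "(cmod (indicator A x))\<^sup>2 = (indicator A x :: real)" for A :: "real set" and x
      by (simp add: indicator_def)
    moreover have "measure M {h..<2 * h} = r * measure M {0..<h}"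
    proof -
      have "(\<lambda>x. x - h) -` {0..<h} = {h..<2 * h}" by auto
      then show ?thesis
        using scaled[of "{0..<h}"] r by (simp add: measure_def enn2real_mult)
    qed
    ultimately show ?thesis by simp
  qed
  define a where "a = (\<integral>x. (cmod (?f x))\<^sup>2 \<partial>M)"
  have a: "a > 0"
  proof -
    have "a = (\<integral>x. indicator {0..<h} x \<partial>M)"
      unfolding a_def by (intro Bochner_Integration.integral_cong) (auto simp: indicator_def)
    then show ?thesis using pos by simp
  qed
  \<comment> \<open>Then \<open>a - \<epsilon>\<close> is exactly \<open>a / r\<close>.\<close>
  define \<epsilon> where "\<epsilon> = a * (1 - 1 / r)"
  have "\<epsilon> > 0" using a r by (simp add: \<epsilon>_def)
  then obtain F c where F: "finite F" "F \<subseteq> \<Lambda>" "L2_norm M (\<lambda>x. ?f x - (\<Sum>i\<in>F. c i * e i x)) < sqrt \<epsilon>"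
    using \<Lambda> f unfolding L2_orthonormal_basis_def by (meson real_sqrt_gt_zero)
  have eF: "e i \<in> L2_space M" "j \<in> F \<Longrightarrow> L2_inner M (e i) (e j) = (if i = j then 1 else 0)"
    if "i \<in> F" for i j
    using \<Lambda> F that unfolding L2_orthonormal_basis_def by blast+
  have pythagoras: "(\<integral>x. (cmod (u x - (\<Sum>i\<in>F. d i * e i x)))\<^sup>2 \<partial>M) =
      (\<integral>x. (cmod (u x))\<^sup>2 \<partial>M) - (\<Sum>i\<in>F. (cmod (L2_inner M u (e i)))\<^sup>2)
        + (\<Sum>i\<in>F. (cmod (d i - L2_inner M u (e i)))\<^sup>2)" if "u \<in> L2_space M" for u d
    using that F(1) eF by (rule L2_pythagoras)
  define s where "s = (\<Sum>i\<in>F. (cmod (L2_inner M ?f (e i)))\<^sup>2)"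
  have "a - s \<le> (\<integral>x. (cmod (?f x - (\<Sum>i\<in>F. c i * e i x)))\<^sup>2 \<partial>M)"
    unfolding pythagoras[OF f] a_def s_def by (simp add: sum_nonneg)
  also have "\<dots> < \<epsilon>" using F(3) by (simp add: L2_norm_def)
  finally have 1: "a - s < \<epsilon>" .
  have "0 \<le> (\<integral>x. (cmod (?g x - (\<Sum>i\<in>F. L2_inner M ?g (e i) * e i x)))\<^sup>2 \<partial>M)" by simp
  also have "\<dots> = r * a - r\<^sup>2 * s"
    unfolding pythagoras[OF g] sq inner a_def s_def
    by (simp add: power_mult_distrib sum_distrib_left)
  finally have "r * s \<le> a" using r by (simp add: power2_eq_square mult.assoc)
  then have "s \<le> a / r" using r by (simp add: field_simps)
  then show False using 1 by (simp add: \<epsilon>_def algebra_simps)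
qed

section \<open>The uniform distribution on an interval as an infinite convolution\<close>

lemma real_distribution_uniform_interval:
  "b > 0 \<Longrightarrow> real_distribution (uniform_measure lborel {0..b :: real})"
  by (auto simp: real_distribution_def real_distribution_axioms_def intro!: prob_space_uniform_measure)

lemma char_uniform_interval:
  assumes "b > 0" "s \<noteq> 0"
  shows "char (uniform_measure lborel {0..b}) s = (cis (s * b) - 1) / (\<i> * s * b)"
proof -
  have "char (uniform_measure lborel {0..b}) s =
      (\<integral>x. (indicator {0..b} x / b) *\<^sub>R iexp (s * x) \<partial>lborel)"
  proof -
    have "uniform_measure lborel {0..b} = density lborel (\<lambda>x. ennreal (indicator {0..b} x / b))"
      unfolding uniform_measure_def using assms
      by (intro density_cong) (auto simp: indicator_def divide_ennreal[symmetric])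
    then show ?thesis
      unfolding char_def using assms by (simp add: integral_density)
  qed
  also have "\<dots> = (\<integral>x. indicator {0..b} x *\<^sub>R iexp (s * x) \<partial>lborel) / b"
    by (simp add: scaleR_conv_of_real flip: integral_divide_zero)
  also have "(\<integral>x. indicator {0..b} x *\<^sub>R iexp (s * x) \<partial>lborel) = cis (s * b) / (\<i> * s) - cis (s * 0) / (\<i> * s)"
  proof (rule integral_FTC_Icc)
    show "((\<lambda>x. cis (s * x) / (\<i> * s)) has_vector_derivative iexp (s * x)) (at x within {0..b})" for x
    proof -
      have "((\<lambda>z. exp (\<i> * s * z) / (\<i> * s)) has_field_derivative exp (\<i> * s * of_real x)) (at (of_real x))"
        using assms(2) by (auto intro!: derivative_eq_intros)
      from has_vector_derivative_real_field[OF this] show ?thesis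
        by (simp add: cis_conv_exp mult.assoc)
    qed
  qed (use assms in \<open>auto intro!: continuous_intros\<close>)
  finally show ?thesis by (simp add: diff_divide_distrib)
qed

text \<open>The Fourier form of cutting the interval into \<open>N\<close> equal pieces. The
  frequency 0 is separate because the closed formula divides by the frequency.\<close>

lemma char_uniform_interval_refine:
  assumes "b > 0" "N > 0"
  shows "char (uniform_measure lborel {0..b}) (2 * pi * \<xi>) =
    mask_poly N (b * \<xi> / N) * char (uniform_measure lborel {0..b}) (2 * pi * (\<xi> / N))"
proof (cases "\<xi> = 0")
  case False
  have "of_nat N * mask_poly N (b * \<xi> / N) * (cis (2 * pi * (b * \<xi> / N)) - 1) = cis (2 * pi * (b * \<xi>)) - 1"
    using mask_poly_geometric[of N "b * \<xi> / N"] assms by simp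
  then show ?thesis using assms False
    by (simp add: char_uniform_interval) (simp add: field_simps)
next
  case True
  interpret real_distribution "uniform_measure lborel {0..b}"
    using assms(1) by (rule real_distribution_uniform_interval)
  show ?thesis using True assms by (simp add: char_zero)
qed

text \<open>Iterating the refinement leaves a remaining factor that tends to 1 by continuity at 0,
  so one may divide by it eventually.\<close>

lemma char_uniform_interval_LIMSEQ:
  assumes "b > 0" "N \<ge> 2"
  shows "(\<lambda>n. \<Prod>k<n. mask_poly N (b * \<xi> / real N ^ Suc k)) \<longlonglongrightarrow>
    char (uniform_measure lborel {0..b}) (2 * pi * \<xi>)"
proof -
  interpret real_distribution "uniform_measure lborel {0..b}"
    using assms(1) by (rule real_distribution_uniform_interval)
  let ?\<phi> = "\<lambda>\<xi>. char (uniform_measure lborel {0..b}) (2 * pi * \<xi>)"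
  have eq: "?\<phi> \<xi> = (\<Prod>k<n. mask_poly N (b * \<xi> / real N ^ Suc k)) * ?\<phi> (\<xi> / real N ^ n)" for n
  proof (induction n)
    case (Suc n)
    then show ?case
      using char_uniform_interval_refine[of b N "\<xi> / real N ^ n"] assms
      by (simp add: mult_ac)
  qed simp
  have "(\<lambda>n. \<xi> / real N ^ n) \<longlonglongrightarrow> 0" using assms by (intro LIMSEQ_divide_realpow_zero) auto
  then have "(\<lambda>n. 2 * pi * (\<xi> / real N ^ n)) \<longlonglongrightarrow> 2 * pi * 0" by (intro tendsto_intros)
  then have lim: "(\<lambda>n. ?\<phi> (\<xi> / real N ^ n)) \<longlonglongrightarrow> 1"
    using isCont_tendsto_compose[OF isCont_char, of _ 0] by (simp add: char_zero)
  then have "(\<lambda>n. ?\<phi> \<xi> / ?\<phi> (\<xi> / real N ^ n)) \<longlonglongrightarrow> ?\<phi> \<xi> / 1"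
    by (intro tendsto_intros) auto
  moreover have "eventually (\<lambda>n. ?\<phi> (\<xi> / real N ^ n) \<noteq> 0) sequentially"
    using lim by (rule tendsto_imp_eventually_ne) simp
  then have "eventually (\<lambda>n. ?\<phi> \<xi> / ?\<phi> (\<xi> / real N ^ n) =
      (\<Prod>k<n. mask_poly N (b * \<xi> / real N ^ Suc k))) sequentially"
  proof eventually_elim
    case (elim n)
    then show ?case by (subst eq[of n]) simp
  qed
  ultimately show ?thesis
    using Lim_transform_eventually by fastforce
qed

lemma emeasure_convolution_pos:
  assumes "real_distribution A" "real_distribution B" "emeasure A {x} > 0" "emeasure B {y} > 0"
  shows "emeasure (convolution A B) {x + y} > 0"
proof -
  interpret A: real_distribution A by fact
  interpret B: real_distribution B by fact
  have "emeasure (convolution A B) {x + y} = (\<integral>\<^sup>+z. emeasure B {a. a + z \<in> {x + y}} \<partial>A)"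
    by (rule convolution_emeasure) (auto intro: A.finite_measure_axioms B.finite_measure_axioms)
  also have "\<dots> \<ge> (\<integral>\<^sup>+z. emeasure B {y} * indicator {x} z \<partial>A)"
  proof (intro nn_integral_mono)
    fix z
    have "{a. a + x = x + y} = {y}" by auto
    then show "emeasure B {y} * indicator {x} z \<le> emeasure B {a. a + z \<in> {x + y}}"
      by (auto simp: indicator_def)
  qed
  also have "(\<integral>\<^sup>+z. emeasure B {y} * indicator {x} z \<partial>A) = emeasure B {y} * emeasure A {x}"
    by (simp add: nn_integral_cmult_indicator)
  finally have "emeasure B {y} * emeasure A {x} \<le> emeasure (convolution A B) {x + y}" .
  moreover have "0 < emeasure B {y} * emeasure A {x}"
    using assms(3,4) by (simp add: ennreal_zero_less_mult_iff)
  ultimately show ?thesis by (rule less_le_trans[rotated])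
qed

lemma emeasure_uniform_dirac_pos:
  assumes "finite A" "a \<in> A"
  shows "emeasure (uniform_dirac A) {a} > 0"
proof -
  have "emeasure (uniform_dirac A) {a} = ennreal (pmf (pmf_of_set A) a)"
    unfolding uniform_dirac_def by (simp add: emeasure_distr emeasure_pmf_single)
  moreover have "pmf (pmf_of_set A) a > 0"
    using assms by (subst pmf_of_set) (auto simp: card_gt_0_iff)
  ultimately show ?thesis by simp
qed

section \<open>Sequences with a last symbol 1 when \<open>t = 1\<close>\<close>

context moran
begin

lemma AE_partial_lattice: "AE x in partial_convolution piece n. x \<in> (\<lambda>i. real i / M ^ Suc n) ` UNIV"
proof -
  define Z where "Z n = range (\<lambda>i. real i / M ^ Suc n)" for n
  have Z: "Z n \<in> sets borel" for n
    unfolding Z_def by (rule sets.countable) auto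
  have ZI: "real i / M ^ Suc n \<in> Z n" for i n unfolding Z_def by blast
  have piece: "AE x in piece k. x \<in> Z k" for k
  proof (rule AE_piece[OF Z])
    show "real (c k) * real j / M ^ Suc k \<in> Z k" for j
      using ZI[of "c k * j" k] by (simp only: of_nat_mult)
  qed
  have "AE x in partial_convolution piece n. x \<in> Z n"
  proof (induction n)
    case 0
    then show ?case by (simp only: partial_convolution.simps piece)
  next
    case (Suc n)
    show ?case unfolding partial_convolution.simps
    proof (rule AE_convolution[OF real_distribution_partial real_distribution_piece Suc piece Z])
      fix x y assume "x \<in> Z n" "y \<in> Z (Suc n)"
      then obtain i j where "x = real i / M ^ Suc n" "y = real j / M ^ Suc (Suc n)" by (auto simp: Z_def)
      moreover have "real i / M ^ Suc n = real i * M / M ^ Suc (Suc n)" using M by simp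
      moreover have "real (i * (t * N) + j) = real i * M + real j" by (simp add: M_def)
      ultimately have "x + y = real (i * (t * N) + j) / M ^ Suc (Suc n)"
        by (simp only: add_divide_distrib)
      then show "x + y \<in> Z (Suc n)" by (simp only: ZI)
    qed
  qed
  then show ?thesis by (simp only: Z_def)
qed

lemma emeasure_piece_pos: "j < N \<Longrightarrow> emeasure (piece k) {real (c k) * real j / M ^ Suc k} > 0"
  unfolding piece_altdef by (intro emeasure_uniform_dirac_pos) auto

lemma emeasure_partial_0_pos: "emeasure (partial_convolution piece n) {0} > 0"
proof (induction n)
  case (Suc n)
  then show ?case
    using emeasure_convolution_pos[OF real_distribution_partial real_distribution_piece
        Suc emeasure_piece_pos[of 0 "Suc n"]] N
    by simp
qed (use emeasure_piece_pos[of 0 0] N in simp)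

lemma emeasure_partial_step_pos:
  assumes "c n = 1"
  shows "emeasure (partial_convolution piece n) {1 / M ^ Suc n} > 0"
proof (cases n)
  case 0
  then show ?thesis using emeasure_piece_pos[of 1 0] N assms by simp
next
  case (Suc m)
  then show ?thesis
    using emeasure_convolution_pos[OF real_distribution_partial real_distribution_piece
        emeasure_partial_0_pos[of m] emeasure_piece_pos[of 1 "Suc m"]] N assms by simp
qed

text \<open>Behind position \<open>m\<close> all dilations are \<open>p\<close> and
  \<open>M = N\<close>, so the tail is the product that represents the transform of the uniform
  distribution; characteristic functions determine the measure.\<close>

lemma mu_eq_convolution_uniform:
  assumes "t = 1" "p \<ge> 1" "\<And>k. k > m \<Longrightarrow> c k = p"
  shows "mu = convolution (partial_convolution piece m) (uniform_measure lborel {0..p / M ^ Suc m})"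
    (is "_ = convolution ?P ?U")
proof (rule Levy_uniqueness[OF real_distribution_mu])
  have b: "real p / M ^ Suc m > 0" using assms(2) M by simp
  note U = real_distribution_uniform_interval[OF b]
  show "real_distribution (convolution ?P ?U)"
    by (intro real_distribution_convolution real_distribution_partial U)
  have "char ?U (2 * pi * \<xi>) = tail (Suc m) (\<xi> / M ^ Suc m)" for \<xi>
  proof (rule LIMSEQ_unique)
    have "mask_poly N (p / M ^ Suc m * \<xi> / real N ^ Suc k) = factor (Suc m + k) (\<xi> / M ^ Suc m / M ^ Suc k)" for k
    proof -
      have "M = real (t * N)" by (rule M_def)
      then have "M = real N" using assms(1) by (metis mult_1)
      then show ?thesis using assms(3)[of "Suc m + k"] by (simp add: factor_def mult_ac)
    qed
    then show "(\<lambda>n. \<Prod>k<n. factor (Suc m + k) (\<xi> / M ^ Suc m / M ^ Suc k)) \<longlonglongrightarrow> char ?U (2 * pi * \<xi>)"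
      using char_uniform_interval_LIMSEQ[OF b N, of \<xi>] by (simp only:)
  qed (rule tail_LIMSEQ)
  then have "char mu (2 * pi * \<xi>) = char (convolution ?P ?U) (2 * pi * \<xi>)" for \<xi>
    using char_convolution[OF real_distribution_partial U] tail_0_split[of \<xi> "Suc m"]
    by (simp only: char_mu char_partial)
  from this[of "_ / (2 * pi)"] show "char mu = char (convolution ?P ?U)"
    by (intro ext) simp
qed

text \<open>With \<open>h\<close> the lattice spacing of the discrete part \<open>?P\<close>, each
  atom is smeared over an interval of length \<open>p * h\<close>, which is at least
  \<open>2 * h\<close>. The interval \<open>[0, h)\<close> is reached from the atom at 0 only,
  \<open>[h, 2h)\<close> from those at 0 and \<open>h\<close>. Both have positive mass because the
  digit 1 at position \<open>m\<close> has dilation 1, so the ratio of the densities exceeds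
  1.\<close>

lemma not_spectral_mu:
  assumes "t = 1" "p \<ge> 2" "\<And>k. k > m \<Longrightarrow> c k = p" "c m = 1"
  shows "\<not> spectral_measure mu"
proof -
  define h where "h = 1 / M ^ Suc m"
  have h: "h > 0" using M by (simp add: h_def)
  let ?P = "partial_convolution piece m" and ?U = "uniform_measure lborel {0..p * h}"
  have b: "real p * h > 0" "2 * h \<le> real p * h" using assms(2) h by auto
  have sub: "{0..<h} \<subseteq> {0..real p * h}"
    using b(2) h unfolding subset_iff atLeastLessThan_iff atLeastAtMost_iff by (intro allI impI) linarith
  note P = real_distribution_partial[of m] and U = real_distribution_uniform_interval[OF b(1)]
  interpret P: real_distribution ?P by (rule P)
  interpret U: real_distribution ?U by (rule U)
  have mu: "mu = convolution ?P ?U"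
    using mu_eq_convolution_uniform[of m] assms by (simp add: h_def)
  have lattice: "AE x in ?P. \<exists>i. x = real i * h"
    using AE_partial_lattice[of m] by eventually_elim (auto simp: h_def)
  have mu_eq: "emeasure mu A = (\<integral>\<^sup>+x. emeasure ?U {a. a + x \<in> A} \<partial>?P)" if "A \<in> sets borel" for A
    unfolding mu using that
    by (intro convolution_emeasure) (auto intro: P.finite_measure_axioms U.finite_measure_axioms)
  have U_eq: "emeasure ?U A = emeasure lborel (A \<inter> {0..real p * h}) / ennreal (p * h)" if "A \<in> sets borel" for A
    using that b by (simp add: Int_commute)
  \<comment> \<open>The value of the uniform distribution on a translate of \<open>A\<close> that
    lies inside its interval.\<close>
  define \<beta> where "\<beta> A = emeasure lborel A / ennreal (p * h)" for A :: "real set"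
  have low: "emeasure mu A = \<beta> A * emeasure ?P {0}" if A: "A \<in> sets borel" "A \<subseteq> {0..<h}" for A
  proof -
    have "emeasure mu A = (\<integral>\<^sup>+x. \<beta> A * indicator {0} x \<partial>?P)"
      unfolding mu_eq[OF A(1)]
    proof (rule nn_integral_cong_AE, use lattice in eventually_elim)
      case (elim x)
      then obtain i where x: "x = real i * h" by blast
      have meas: "{a. a + x \<in> A} \<in> sets borel"
        using measurable_sets[of "\<lambda>a. a + x" borel borel A] A by (simp add: vimage_def)
      show ?case
      proof (cases "i = 0")
        case True
        have "A \<inter> {0..real p * h} = A" using A sub by blast
        then show ?thesis using True x A by (simp add: U_eq[OF A(1)] \<beta>_def)
      next
        case False
        then have "h \<le> x" using x h by simp
        then have "{a. a + x \<in> A} \<inter> {0..real p * h} = {}" using A by force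
        then show ?thesis using \<open>h \<le> x\<close> h unfolding U_eq[OF meas] by simp
      qed
    qed
    then show ?thesis by (simp add: nn_integral_cmult_indicator)
  qed
  have high: "emeasure mu ((\<lambda>x. x - h) -` A) = \<beta> A * emeasure ?P {0, h}" if A: "A \<in> sets borel" "A \<subseteq> {0..<h}" for A
  proof -
    have meas: "(\<lambda>a. a + y) -` A \<in> sets borel" for y
      using measurable_sets[of "\<lambda>a. a + y" borel borel A] A by simp
    have "emeasure mu ((\<lambda>x. x - h) -` A) = (\<integral>\<^sup>+x. \<beta> A * indicator {0, h} x \<partial>?P)"
      unfolding mu_eq[OF meas[of "- h", simplified]]
    proof (rule nn_integral_cong_AE, use lattice in eventually_elim)
      case (elim x)
      then obtain i where x: "x = real i * h" by blast
      have eq: "{a. a + x \<in> (\<lambda>x. x - h) -` A} = (\<lambda>a. a + (x - h)) -` A" by (auto simp: algebra_simps)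
      \<comment> \<open>The intervals of the atoms at 0 and \<open>h\<close> cover
        \<open>[h, 2h)\<close>, the first one because \<open>p \<ge> 2\<close>; those of later atoms
        start at \<open>2 * h\<close> or beyond.\<close>
      consider "i = 0" | "i = 1" | "i \<ge> 2" by linarith
      then show ?case
      proof cases
        case 1
        have "(\<lambda>a. a + (x - h)) -` A \<inter> {0..real p * h} = (\<lambda>a. a + (x - h)) -` A"
        proof (rule Int_absorb2, rule subsetI)
          fix a assume "a \<in> (\<lambda>a. a + (x - h)) -` A"
          then have "a + (x - h) \<in> {0..<h}" using A by blast
          then have "0 \<le> a" "a \<le> 2 * h" using h x 1 by auto
          then show "a \<in> {0..real p * h}" using b(2) by (auto intro: order_trans)
        qed
        moreover have "emeasure lborel ((\<lambda>a. a + (x - h)) -` A) = emeasure lborel A"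
        proof -
          have "emeasure lborel A = emeasure (distr lborel borel ((+) (x - h))) A"
            by (simp add: lborel_distr_plus)
          also have "\<dots> = emeasure lborel ((+) (x - h) -` A)"
            using A by (subst emeasure_distr) auto
          also have "(+) (x - h) -` A = (\<lambda>a. a + (x - h)) -` A" by (auto simp: add.commute)
          finally show ?thesis ..
        qed
        ultimately show ?thesis unfolding eq U_eq[OF meas] using 1 x by (simp add: \<beta>_def)
      next
        case 2
        have "A \<inter> {0..real p * h} = A" using A sub by blast
        then show ?thesis unfolding eq U_eq[OF meas] using 2 x by (simp add: \<beta>_def)
      next
        case 3
        then have "real i * h \<ge> 2 * h" using h by (intro mult_right_mono) auto
        then have "x \<ge> 2 * h" using x by simp
        then have "(\<lambda>a. a + (x - h)) -` A \<inter> {0..real p * h} = {}" using A by force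
        then show ?thesis unfolding eq U_eq[OF meas] using \<open>x \<ge> 2 * h\<close> h by simp
      qed
    qed
    then show ?thesis by (simp add: nn_integral_cmult_indicator)
  qed
  have P0: "P.prob {0} > 0" and Ph: "P.prob {h} > 0"
    using emeasure_partial_0_pos[of m] emeasure_partial_step_pos[OF assms(4)]
    by (auto simp: P.emeasure_eq_measure h_def)
  have P0h: "P.prob {0, h} = P.prob {0} + P.prob {h}"
    using P.finite_measure_Union[of "{0}" "{h}"] h by (simp add: insert_commute)
  show ?thesis
  proof (rule not_spectral_if_translate_scaled[OF real_distribution_mu, of "P.prob {0, h} / P.prob {0}" h])
    show "P.prob {0, h} / P.prob {0} > 1" using P0 Ph P0h by simp
    have "emeasure mu {0..<h} > 0"
      using low[of "{0..<h}"] P0 h b by (simp add: \<beta>_def P.emeasure_eq_measure divide_ennreal ennreal_zero_less_mult_iff)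
    then show "measure mu {0..<h} > 0"
      using real_distribution_mu by (simp add: finite_measure.emeasure_eq_measure real_distribution_def prob_space_def)
    fix A :: "real set" assume A: "A \<in> sets borel" "A \<subseteq> {0..<h}"
    have "emeasure ?P {0, h} = ennreal (P.prob {0, h} / P.prob {0}) * emeasure ?P {0}"
      using P0 by (simp add: P.emeasure_eq_measure flip: ennreal_mult)
    then show "emeasure mu ((\<lambda>x. x - h) -` A) = ennreal (P.prob {0, h} / P.prob {0}) * emeasure mu A"
      unfolding low[OF A] high[OF A] by (simp add: mult_ac)
  qed
qed

end

section \<open>The cases of the theorem\<close>

context moran
begin

lemma spectral_mu_if_t_ge_2:
  assumes "t \<ge> 2" "p \<ge> 1" "Rings.coprime p N" "\<And>k. c k \<in> {1, p}"
  shows "spectral_measure mu"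
proof -
  obtain \<Lambda> where "\<And>l l'. l \<in> \<Lambda> \<Longrightarrow> l' \<in> \<Lambda> \<Longrightarrow> l \<noteq> l' \<Longrightarrow> tail 0 (l - l') = 0"
    "\<And>\<xi> \<eta>. \<eta> > 0 \<Longrightarrow> \<exists>F. finite F \<and> F \<subseteq> \<Lambda> \<and> (\<Sum>l\<in>F. (cmod (tail 0 (\<xi> + l)))\<^sup>2) > 1 - \<eta>"
    using spectrum_exists_if_t_ge_2[OF assms] by blast
  then show ?thesis
    by (intro spectral_measure_if_tail[OF real_distribution_mu AE_mu_bounded, of 1]) (simp_all add: char_mu)
qed

lemma spectral_mu_if_t_eq_1:
  assumes "t = 1" "Rings.coprime p N" "\<And>k. c k \<in> {1, p}" "infinite {k. c k = 1}"
  shows "spectral_measure mu"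
proof -
  obtain \<Lambda> where "\<And>l l'. l \<in> \<Lambda> \<Longrightarrow> l' \<in> \<Lambda> \<Longrightarrow> l \<noteq> l' \<Longrightarrow> tail 0 (l - l') = 0"
    "\<And>\<xi> \<eta>. \<eta> > 0 \<Longrightarrow> \<exists>F. finite F \<and> F \<subseteq> \<Lambda> \<and> (\<Sum>l\<in>F. (cmod (tail 0 (\<xi> + l)))\<^sup>2) > 1 - \<eta>"
    using spectrum_exists_if_t_eq_1[OF assms] by blast
  then show ?thesis
    by (intro spectral_measure_if_tail[OF real_distribution_mu AE_mu_bounded, of 1]) (simp_all add: char_mu)
qed

end

theorem theorem1p6:
  fixes t N p :: nat
  assumes "t \<ge> 1" and "N \<ge> 2" and "p \<ge> 2" and "coprime N p"
  shows "(t = 1 \<longrightarrow> (\<forall>\<omega> \<in> (UNIV :: nat set) \<rightarrow> {1, 2::nat}.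
            spectral_measure (mu_omega t N p \<omega>) \<longleftrightarrow>
              \<omega> = (\<lambda>k. 2) \<or> infinite {k. \<omega> k = 1})) \<and>
         (t \<ge> 2 \<longrightarrow> (\<forall>\<omega> \<in> (UNIV :: nat set) \<rightarrow> {1, 2::nat}.
            spectral_measure (mu_omega t N p \<omega>)))"
proof -
  have cop: "coprime p N" using assms(4) by (simp add: coprime_commute)
  define c where "c \<omega> k = (if \<omega> k = 1 then 1 else p)" for \<omega> :: "nat \<Rightarrow> nat" and k
  have moran: "moran t N p (c \<omega>)" for \<omega>
    using assms cop by unfold_locales (auto simp: c_def)
  have c: "c \<omega> k \<in> {1, p}" and c1: "c \<omega> k = 1 \<longleftrightarrow> \<omega> k = 1" for \<omega> k
    using assms(3) by (auto simp: c_def)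
  have mu: "mu_omega t N p \<omega> = moran.mu t N (c \<omega>)" for \<omega>
  proof -
    interpret moran t N p "c \<omega>" by (rule moran)
    have "(\<lambda>b. real (c \<omega> k) * b) ` real ` {0..<N} = digit_set N p (\<omega> k)" for k
      by (simp add: c_def digit_set_def)
    then have "piece k = uniform_dirac ((\<lambda>b. inverse (real (t * N) ^ Suc k) * b) ` digit_set N p (\<omega> k))" for k
      unfolding piece_def M_def by (simp only:)
    then have "piece = (\<lambda>k. uniform_dirac ((\<lambda>b. inverse (real (t * N) ^ Suc k) * b) ` digit_set N p (\<omega> k)))"
      by (rule ext)
    then show ?thesis by (simp only: mu_omega_def mu_def)
  qed
  have spectral: "spectral_measure (moran.mu t N (c \<omega>))" if "t \<ge> 2 \<or> t = 1 \<and> infinite {k. \<omega> k = 1}" for \<omega>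
  proof -
    interpret moran t N p "c \<omega>" by (rule moran)
    show ?thesis
      using that
    proof
      assume "t \<ge> 2"
      then show ?thesis using assms(3) cop c by (intro spectral_mu_if_t_ge_2) auto
    next
      assume t: "t = 1 \<and> infinite {k. \<omega> k = 1}"
      then have "infinite {k. c \<omega> k = 1}" unfolding c1 by blast
      then show ?thesis using t cop c by (intro spectral_mu_if_t_eq_1) blast+
    qed
  qed
  have all_2: "spectral_measure (moran.mu t N (c (\<lambda>k. 2)))" if "t = 1"
  proof -
    interpret A: moran t N p "c (\<lambda>k. 2)" by (rule moran)
    \<comment> \<open>The constant sequence 1, with 1 also as the bound: every tail starts with
      dilation 1. The transform for the constant sequence 2 is that of \<open>B\<close> at
      \<open>p\<close> times the argument.\<close>
    interpret B: moran t N 1 "\<lambda>k. 1"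
      using assms by unfold_locales auto
    obtain \<Lambda> where \<Lambda>: "\<And>l l'. l \<in> \<Lambda> \<Longrightarrow> l' \<in> \<Lambda> \<Longrightarrow> l \<noteq> l' \<Longrightarrow> B.tail 0 (l - l') = 0"
      "\<And>\<xi> \<eta>. \<eta> > 0 \<Longrightarrow> \<exists>F. finite F \<and> F \<subseteq> \<Lambda> \<and> (\<Sum>l\<in>F. (cmod (B.tail 0 (\<xi> + l)))\<^sup>2) > 1 - \<eta>"
      using B.spectrum_exists_if_t_eq_1 \<open>t = 1\<close> by auto
    have "char A.mu (2 * pi * \<xi>) = B.tail 0 (real p * \<xi>)" for \<xi>
      unfolding A.char_mu A.tail_def B.tail_def A.factor_def B.factor_def by (simp add: c_def)
    moreover have "real p > 0" using assms(3) by simp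
    ultimately show ?thesis
      by (intro B.spectral_measure_if_tail[OF A.real_distribution_mu A.AE_mu_bounded _ _ \<Lambda>])
  qed
  have not_spectral: "\<not> spectral_measure (moran.mu t N (c \<omega>))"
    if "t = 1" "\<omega> \<in> UNIV \<rightarrow> {1, 2}" "\<omega> \<noteq> (\<lambda>k. 2)" "finite {k. \<omega> k = 1}" for \<omega>
  proof -
    interpret moran t N p "c \<omega>" by (rule moran)
    have "\<exists>k. \<omega> k = 1" using that(2,3) by (auto simp: Pi_iff fun_eq_iff)
    then have ne: "{k. \<omega> k = 1} \<noteq> {}" by blast
    \<comment> \<open>The position of the last symbol 1; it exists because \<omega> has values 1 and
      2 only, is not constantly 2, and has finitely many 1s.\<close>
    define m where "m = Max {k. \<omega> k = 1}"
    have "\<omega> m = 1" using Max_in[OF that(4) ne] by (simp add: m_def)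
    moreover have "\<omega> k \<noteq> 1" if "k > m" for k
      using Max_ge[OF \<open>finite {k. \<omega> k = 1}\<close>, of k] that by (auto simp: m_def)
    ultimately show ?thesis
      using that(1) assms(3) by (intro not_spectral_mu[of m]) (auto simp: c_def)
  qed
  show ?thesis
    unfolding mu using spectral all_2 not_spectral by blast
qed

end
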